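(* The following statements are equivalent for every cardinal $\kappa$: (i) $\kappa$ is measurable. (ii) For all sufficiently large cardinals $\theta$, there is a small embedding $j:M\longrightarrow \mathrm{H}(\theta)$ for $\kappa$ with $$\{A\in\mathcal{P}(\mathrm{crit}(j))^M\mid \mathrm{crit}(j)\in j(A)\}\ \in\ M.$$
   Context: $\mathrm{H}(\theta)$ is the set of all sets whose transitive closure has cardinality less than $\theta$. An elementary embedding $j:M\to N$ between transitive classes is non-trivial if there is an ordinal $\alpha\in M$ with $j(\alpha)>\alpha$; then $\mathrm{crit}(j)$ denotes the least such ordinal. Given cardinals $\kappa<\theta$, a non-trivial elementary embedding $j:M\to \mathrm{H}(\theta)$ is a small embedding for $\kappa$ if $M\in \mathrm{H}(\theta)$ is transitive and $j(\mathrm{crit}(j))=\kappa$. "For all sufficiently large cardinals $\theta$" means: there is an ordinal $\alpha\geq\kappa$ such that the statement holds for all cardinals $\theta>\alpha$. Measurable cardinals are uncountable. *)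

theory Defs
  imports Main "HOL-Library.Equipollence" "HOL-Library.Countable_Set"
begin

text \<open>
  The set-theoretic universe is a type whose elements are the sets of a model of ZFC, given by
  \<open>elts x\<close>, the collection of the elements of \<open>x\<close>. Objects of type \<open>'v set\<close> play the role
  of classes; those of the form \<open>elts x\<close> are the sets. As usual for set theory in
  higher-order logic, Separation and Replacement range over all HOL collections and functions.
  Consequently every subclass of a set and every function on a set is itself a set of the
  universe, and Choice follows from Hilbert choice and Replacement.
\<close>

class zfc =
  fixes elts :: "'a \<Rightarrow> 'a set"
  assumes extensionality: "elts x = elts y \<Longrightarrow> x = y"
    and foundation: "wf {(x, y). x \<in> elts y}"
    and separation: "\<exists>y. elts y = {z \<in> elts x. P z}"
    and union: "\<exists>y. elts y = (\<Union>z \<in> elts x. elts z)"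
    and powerset: "\<exists>y. elts y = {z. elts z \<subseteq> elts x}"
    and replacement: "\<exists>y. elts y = f ` elts x"
    and infinity: "\<exists>y. elts y = range (g :: nat \<Rightarrow> 'a)"

definition Transitive :: "'v::zfc set \<Rightarrow> bool" where
  "Transitive T \<longleftrightarrow> (\<forall>x \<in> T. elts x \<subseteq> T)"

text \<open>By Foundation, these are the von Neumann ordinals. For ordinals, \<open>\<alpha> < \<beta>\<close> is
  \<open>\<alpha> \<in> elts \<beta>\<close> and \<open>\<alpha> \<le> \<beta>\<close> is \<open>elts \<alpha> \<subseteq> elts \<beta>\<close>.\<close>

definition Ord :: "'v::zfc \<Rightarrow> bool" where
  "Ord \<alpha> \<longleftrightarrow> Transitive (elts \<alpha>) \<and> (\<forall>x \<in> elts \<alpha>. Transitive (elts x))"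

definition Card :: "'v::zfc \<Rightarrow> bool" where
  "Card \<kappa> \<longleftrightarrow> Ord \<kappa> \<and> (\<forall>\<alpha> \<in> elts \<kappa>. \<not> elts \<alpha> \<approx> elts \<kappa>)"

definition trans_closure :: "'v::zfc \<Rightarrow> 'v set" where
  "trans_closure x = \<Inter> {T. elts x \<subseteq> T \<and> Transitive T}"

definition Hset :: "'v::zfc \<Rightarrow> 'v set" where
  "Hset \<theta> = {x. trans_closure x \<prec> elts \<theta>}"

text \<open>First-order formulas of the language of set theory, with variables named by natural
  numbers, and their satisfaction in \<open>(M, \<in>)\<close>.\<close>

datatype fm = Mem nat nat | Eq nat nat | Neg fm | Conj fm fm | Ex nat fm

primrec sat :: "'v::zfc set \<Rightarrow> fm \<Rightarrow> (nat \<Rightarrow> 'v) \<Rightarrow> bool" where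
  "sat M (Mem i k) s \<longleftrightarrow> s i \<in> elts (s k)"
| "sat M (Eq i k) s \<longleftrightarrow> s i = s k"
| "sat M (Neg p) s \<longleftrightarrow> \<not> sat M p s"
| "sat M (Conj p q) s \<longleftrightarrow> sat M p s \<and> sat M q s"
| "sat M (Ex i p) s \<longleftrightarrow> (\<exists>a \<in> M. sat M p (s(i := a)))"

text \<open>An embedding of \<open>M\<close> is a HOL function of which only the values on \<open>M\<close> matter.\<close>

definition elementary :: "'v::zfc set \<Rightarrow> 'v set \<Rightarrow> ('v \<Rightarrow> 'v) \<Rightarrow> bool" where
  "elementary M N j \<longleftrightarrow> j ` M \<subseteq> N \<and>
     (\<forall>p s. range s \<subseteq> M \<longrightarrow> (sat M p s \<longleftrightarrow> sat N p (j \<circ> s)))"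

definition moves :: "'v::zfc set \<Rightarrow> ('v \<Rightarrow> 'v) \<Rightarrow> 'v \<Rightarrow> bool" where
  "moves M j \<alpha> \<longleftrightarrow> \<alpha> \<in> M \<and> Ord \<alpha> \<and> \<alpha> \<in> elts (j \<alpha>)"

definition nontrivial :: "'v::zfc set \<Rightarrow> ('v \<Rightarrow> 'v) \<Rightarrow> bool" where
  "nontrivial M j \<longleftrightarrow> (\<exists>\<alpha>. moves M j \<alpha>)"

definition crit :: "'v::zfc set \<Rightarrow> ('v \<Rightarrow> 'v) \<Rightarrow> 'v" where
  "crit M j = (THE \<alpha>. moves M j \<alpha> \<and> (\<forall>\<beta>. moves M j \<beta> \<longrightarrow> elts \<alpha> \<subseteq> elts \<beta>))"

definition small_embedding :: "'v::zfc \<Rightarrow> 'v \<Rightarrow> 'v \<Rightarrow> ('v \<Rightarrow> 'v) \<Rightarrow> bool" where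
  "small_embedding \<kappa> \<theta> M j \<longleftrightarrow>
     Card \<kappa> \<and> Card \<theta> \<and> \<kappa> \<in> elts \<theta> \<and>
     M \<in> Hset \<theta> \<and> Transitive (elts M) \<and>
     elementary (elts M) (Hset \<theta>) j \<and> nontrivial (elts M) j \<and>
     j (crit (elts M) j) = \<kappa>"

definition ultrafilter_on :: "'a set \<Rightarrow> 'a set set \<Rightarrow> bool" where
  "ultrafilter_on X U \<longleftrightarrow> U \<subseteq> Pow X \<and> X \<in> U \<and> {} \<notin> U \<and>
     (\<forall>A \<in> U. \<forall>B. A \<subseteq> B \<and> B \<subseteq> X \<longrightarrow> B \<in> U) \<and>
     (\<forall>A \<in> U. \<forall>B \<in> U. A \<inter> B \<in> U) \<and>
     (\<forall>A. A \<subseteq> X \<longrightarrow> A \<in> U \<or> X - A \<in> U)"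

definition nonprincipal_on :: "'a set \<Rightarrow> 'a set set \<Rightarrow> bool" where
  "nonprincipal_on X U \<longleftrightarrow> (\<forall>x \<in> X. {x} \<notin> U)"

text \<open>\<open>K\<close> stands for a cardinal: intersections of fewer than \<open>K\<close> members stay in \<open>U\<close>.\<close>

definition complete_for :: "'b set \<Rightarrow> 'a set set \<Rightarrow> bool" where
  "complete_for K U \<longleftrightarrow> (\<forall>\<A>. \<A> \<subseteq> U \<and> \<A> \<noteq> {} \<and> \<A> \<prec> K \<longrightarrow> \<Inter>\<A> \<in> U)"

definition measurable_card :: "'v::zfc \<Rightarrow> bool" where
  "measurable_card \<kappa> \<longleftrightarrow> Card \<kappa> \<and> uncountable (elts \<kappa>) \<and>
     (\<exists>U. ultrafilter_on (elts \<kappa>) U \<and> nonprincipal_on (elts \<kappa>) U \<and> complete_for (elts \<kappa>) U)"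

end

theory Submission imports Defs begin

text \<open>
  From a measure to small embeddings. Fix a normal measure \<open>W\<close> on \<open>\<kappa>\<close>; one is obtained by pushing a
  given measure forward along a least function that is unbounded modulo it
  (\<open>ex_normal_measure\<close>). Inside \<open>H(\<theta>)\<close> take, for each \<open>\<beta> < \<kappa>\<close>, the Skolem hull \<open>Z\<^sub>\<beta>\<close> of \<open>\<kappa>\<close>, \<open>W\<close> and
  \<open>\<beta> + 1\<close>. It has fewer than \<open>\<kappa>\<close> elements, so by completeness measure-one many \<open>\<alpha>\<close> belong to all
  members of \<open>W\<close> in \<open>Z\<^sub>\<beta>\<close> and exceed all ordinals below \<open>\<kappa>\<close> in \<open>Z\<^sub>\<beta>\<close>; by normality some \<open>\<alpha> > 0\<close> does so
  for all \<open>\<beta> < \<alpha>\<close> simultaneously. The union \<open>Y\<close> of these \<open>Z\<^sub>\<beta>\<close> is an elementary submodel of \<open>H(\<theta>)\<close> with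
  \<open>Y \<inter> \<kappa> = \<alpha>\<close>, and for every subset \<open>A\<close> of \<open>\<kappa>\<close> in \<open>Y\<close> we have \<open>A \<in> W\<close> if and only if \<open>\<alpha> \<in> A\<close>
  (\<open>ex_reflecting_submodel\<close>). Let \<open>j : M \<rightarrow> H(\<theta>)\<close> be the inverse of the transitive collapse of \<open>Y\<close>.
  Its critical point is \<open>\<alpha>\<close>, it sends \<open>\<alpha>\<close> to \<open>\<kappa>\<close>, and the collapse of \<open>W\<close> is exactly the required
  element of \<open>M\<close> (\<open>ex_small_embedding\<close>). So the usual argument by elementarity of an ultrapower
  embedding of the universe is replaced by a direct choice of \<open>\<alpha>\<close>.

  From small embeddings to a measure. Let \<open>\<mu>\<close> be the critical point of \<open>j : M \<rightarrow> H(\<theta>)\<close> and \<open>D\<close> the given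
  element of \<open>M\<close>. A subset \<open>A\<close> of \<open>\<mu>\<close> in \<open>M\<close> belongs to \<open>D\<close> when \<open>\<mu> \<in> j(A)\<close>, so \<open>M\<close> believes that \<open>D\<close>
  is a \<open>\<mu>\<close>-complete nonprincipal ultrafilter on \<open>\<mu>\<close>. By elementarity \<open>H(\<theta>)\<close> believes the same about
  \<open>j(D)\<close> and \<open>j(\<mu>) = \<kappa>\<close>, and it is right about this if \<open>\<theta>\<close> exceeds the power set of \<open>\<kappa>\<close>, because then all
  subsets of \<open>\<kappa>\<close> and all families of such subsets lie in \<open>H(\<theta>)\<close>. Only completeness speaks of sequences of
  sets. A sequence \<open>(A\<^sub>\<xi>)\<close> of length \<open>\<nu> < \<kappa>\<close> is coded by the set of all unordered pairs \<open>{\<xi>, \<alpha>}\<close>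
  with \<open>\<xi> < \<nu> \<le> \<alpha>\<close> and \<open>\<alpha> \<in> A\<^sub>\<xi>\<close>. The order of the two components can be read off from \<open>\<nu>\<close>, and what
  is lost below \<open>\<nu>\<close> is negligible (\<open>pair_complete\<close>, \<open>ordinal_complete\<close>).
\<close>

section \<open>Sets and classes\<close>

definition small :: "'v::zfc set \<Rightarrow> bool" where
  "small X \<longleftrightarrow> (\<exists>x. elts x = X)"

definition set_of :: "'v::zfc set \<Rightarrow> 'v" where
  "set_of X = (SOME x. elts x = X)"

lemma elts_set_of [simp]: "small X \<Longrightarrow> elts (set_of X) = X"
  unfolding small_def set_of_def by (rule someI_ex)

lemma set_of_elts [simp]: "set_of (elts x) = x"
  by (rule extensionality, rule elts_set_of) (auto simp: small_def)

lemma small_elts [simp]: "small (elts x)"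
  by (auto simp: small_def)

lemma small_subset: "small X \<Longrightarrow> Y \<subseteq> X \<Longrightarrow> small Y"
proof -
  assume "small X" "Y \<subseteq> X"
  then obtain x where "elts x = X" unfolding small_def by blast
  moreover obtain y where "elts y = {z \<in> elts x. z \<in> Y}"
    using separation[of x "\<lambda>z. z \<in> Y"] by blast
  ultimately show ?thesis using \<open>Y \<subseteq> X\<close> unfolding small_def by (intro exI[of _ y]) blast
qed

lemma small_image:
  fixes f :: "'v::zfc \<Rightarrow> 'v"
  shows "small X \<Longrightarrow> small (f ` X)"
  unfolding small_def using replacement[of f] by blast

lemma small_powerset: "small {v. elts v \<subseteq> elts x}"
  unfolding small_def by (rule powerset)

lemma small_pair: "small {a, b}"
proof -
  have "range (\<lambda>n::nat. if n = 0 then a else b) = {a, b}"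
    by (auto intro: range_eqI[of _ _ 0] range_eqI[of _ _ 1])
  then show ?thesis
    using infinity[of "\<lambda>n. if n = 0 then a else b"] unfolding small_def by auto
qed

lemma small_Un: "small A \<Longrightarrow> small B \<Longrightarrow> small (A \<union> B)"
proof -
  assume "small A" "small B"
  then obtain a b where ab: "elts a = A" "elts b = B" unfolding small_def by blast
  obtain c where c: "elts c = {a, b}" using small_pair unfolding small_def by blast
  obtain y where "elts y = (\<Union>z\<in>elts c. elts z)" using union[of c] by blast
  then show ?thesis using ab c unfolding small_def by (intro exI[of _ y]) auto
qed

lemma small_insert: "small A \<Longrightarrow> small (insert a A)"
  using small_Un[OF small_pair[of a a], of A] by simp

lemma small_lepoll:
  fixes A :: "'v::zfc set" and x :: 'v
  assumes "A \<lesssim> elts x"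
  shows "small A"
proof -
  obtain g where "A \<subseteq> g ` elts x" using assms unfolding lepoll_iff by blast
  then show ?thesis by (rule small_subset[OF small_image[OF small_elts]])
qed

lemma mem_irrefl [simp]: "x \<notin> elts x"
  using foundation wf_not_refl by fastforce

lemma mem_asym: "x \<in> elts y \<Longrightarrow> y \<notin> elts x"
  using foundation wf_not_sym by fastforce

lemma elts_eqI: "(\<And>z. z \<in> elts x \<longleftrightarrow> z \<in> elts y) \<Longrightarrow> x = y"
  by (rule extensionality) blast

section \<open>Ordinals and cardinals\<close>

lemma Ord_in_Ord: "Ord \<alpha> \<Longrightarrow> \<beta> \<in> elts \<alpha> \<Longrightarrow> Ord \<beta>"
  unfolding Ord_def Transitive_def by blast

lemma Ord_trans: "Ord \<alpha> \<Longrightarrow> \<beta> \<in> elts \<alpha> \<Longrightarrow> \<gamma> \<in> elts \<beta> \<Longrightarrow> \<gamma> \<in> elts \<alpha>"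
  unfolding Ord_def Transitive_def by blast

text \<open>By a double \<open>\<in>\<close>-induction: in an incomparable pair all of whose predecessors are comparable,
  each ordinal is included in the other.\<close>

lemma Ord_linear:
  assumes "Ord \<alpha>" "Ord \<beta>"
  shows "\<alpha> \<in> elts \<beta> \<or> \<alpha> = \<beta> \<or> \<beta> \<in> elts \<alpha>"
  using foundation assms
proof (induction \<alpha> arbitrary: \<beta> rule: wf_induct_rule)
  case (less \<alpha>)
  note IH1 = less.IH and oa = less.prems(1)
  from foundation less.prems(2) show ?case
  proof (induction \<beta> rule: wf_induct_rule)
    case (less \<beta>)
    show ?case
    proof (rule ccontr)
      assume no: "\<not> ?case"
      have "x \<in> elts \<beta>" if "x \<in> elts \<alpha>" for x
        using IH1[of x \<beta>] that no less.prems Ord_in_Ord[OF oa] Ord_trans[OF oa that] by auto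
      moreover have "x \<in> elts \<alpha>" if "x \<in> elts \<beta>" for x
        using less.IH[of x] that no Ord_in_Ord[OF less.prems] Ord_trans[OF less.prems that] by auto
      ultimately have "\<alpha> = \<beta>" by (intro elts_eqI) blast
      with no show False by simp
    qed
  qed
qed

lemma Ord_not_mem_iff: "Ord \<alpha> \<Longrightarrow> Ord \<beta> \<Longrightarrow> \<alpha> \<notin> elts \<beta> \<longleftrightarrow> elts \<beta> \<subseteq> elts \<alpha>"
  using Ord_linear[of \<alpha> \<beta>] Ord_trans[of \<alpha> \<beta>] mem_irrefl by blast

lemma Card_Ord: "Card \<kappa> \<Longrightarrow> Ord \<kappa>"
  by (simp add: Card_def)

lemma Card_mem_lesspoll:
  assumes "Card \<kappa>" "\<alpha> \<in> elts \<kappa>"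
  shows "elts \<alpha> \<prec> elts \<kappa>"
proof -
  have "elts \<alpha> \<subseteq> elts \<kappa>" using assms Ord_trans Card_Ord by blast
  then show ?thesis
    using assms by (auto simp: lesspoll_def Card_def eqpoll_sym intro: subset_imp_lepoll)
qed

lemma least_Ord:
  assumes "P \<alpha>" "Ord \<alpha>"
  obtains \<beta> where "P \<beta>" "Ord \<beta>" "\<And>\<gamma>. P \<gamma> \<Longrightarrow> Ord \<gamma> \<Longrightarrow> elts \<beta> \<subseteq> elts \<gamma>"
proof -
  have "\<alpha> \<in> {x. P x \<and> Ord x}" using assms by simp
  from wfE_min[OF foundation this] obtain \<beta>
    where "P \<beta>" "Ord \<beta>" "\<And>\<gamma>. \<gamma> \<in> elts \<beta> \<Longrightarrow> \<not> (P \<gamma> \<and> Ord \<gamma>)" by auto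
  then show thesis using that Ord_not_mem_iff by blast
qed

section \<open>Mostowski collapse\<close>

text \<open>An arbitrary relation is allowed because two kinds occur: a strict well-order collapses to an
  ordinal, and \<open>\<in>\<close> restricted to a submodel collapses to a transitive set.\<close>

definition collapse :: "('v::zfc \<times> 'v) set \<Rightarrow> 'v \<Rightarrow> 'v" where
  "collapse R = wfrec R (\<lambda>f x. set_of (f ` {y. (y, x) \<in> R}))"

lemma elts_collapse:
  assumes "wf R" "\<And>x. small {y. (y, x) \<in> R}"
  shows "elts (collapse R x) = collapse R ` {y. (y, x) \<in> R}"
proof -
  have "collapse R x = set_of (cut (collapse R) R x ` {y. (y, x) \<in> R})"
    unfolding collapse_def by (subst wfrec[OF assms(1)]) simp
  also have "cut (collapse R) R x ` {y. (y, x) \<in> R} = collapse R ` {y. (y, x) \<in> R}"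
    by (rule image_cong) (auto simp: cut_apply)
  finally show ?thesis using assms(2) by (simp add: small_image)
qed

text \<open>The extensionality hypothesis makes the collapse of \<open>\<in>\<close> on \<open>Y\<close> injective, by
  \<open>\<in>\<close>-induction: a point of \<open>Y\<close> that separates \<open>x\<close> from \<open>y\<close> is sent into the common image, hence
  has a partner on the other side, which by induction is the point itself.\<close>

lemma transitive_collapse:
  fixes Y :: "'v::zfc set"
  assumes "small Y"
    and extensional: "\<And>x y. x \<in> Y \<Longrightarrow> y \<in> Y \<Longrightarrow> x \<noteq> y \<Longrightarrow> \<exists>z\<in>Y. \<not> (z \<in> elts x \<longleftrightarrow> z \<in> elts y)"
  obtains M :: 'v and G :: "'v \<Rightarrow> 'v" where "Transitive (elts M)" "elts M = G ` Y" "inj_on G Y"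
    "\<And>x. x \<in> Y \<Longrightarrow> elts (G x) = G ` (elts x \<inter> Y)"
proof -
  define R where "R = {(x, y). x \<in> elts y \<and> x \<in> Y}"
  define G where "G = collapse R"
  have "wf R" by (rule wf_subset[OF foundation]) (auto simp: R_def)
  moreover have "small {y. (y, x) \<in> R}" for x
    by (rule small_subset[OF small_elts[of x]]) (auto simp: R_def)
  ultimately have "elts (G x) = G ` {y. (y, x) \<in> R}" for x
    unfolding G_def by (rule elts_collapse)
  then have G: "elts (G x) = G ` (elts x \<inter> Y)" for x
    by (simp add: R_def Int_def)
  have G_inj: "x = y" if "x \<in> Y" "y \<in> Y" "G x = G y" for x y
    using foundation that
  proof (induction x arbitrary: y rule: wf_induct_rule)
    case (less x)
    show ?case
    proof (rule ccontr)
      assume "x \<noteq> y"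
      then obtain z where z: "z \<in> Y" "\<not> (z \<in> elts x \<longleftrightarrow> z \<in> elts y)"
        using extensional less.prems by blast
      have eq: "G ` (elts x \<inter> Y) = G ` (elts y \<inter> Y)" using G less.prems(3) by metis
      show False
      proof (cases "z \<in> elts x")
        case True
        then have "G z \<in> G ` (elts y \<inter> Y)" using eq z(1) by blast
        then obtain z' where "z' \<in> elts y" "z' \<in> Y" "G z = G z'" by blast
        then have "z = z'" using less.IH[of z z'] True z(1) by simp
        then show False using z True \<open>z' \<in> elts y\<close> by simp
      next
        case False
        then have "G z \<in> G ` (elts x \<inter> Y)" using eq z by blast
        then obtain z' where "z' \<in> elts x" "z' \<in> Y" "G z = G z'" by blast
        then have "z' = z" using less.IH[of z' z] z(1) by simp
        then show False using False \<open>z' \<in> elts x\<close> by simp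
      qed
    qed
  qed
  define M where "M = set_of (G ` Y)"
  have M: "elts M = G ` Y" unfolding M_def using assms(1) by (intro elts_set_of small_image)
  show thesis
  proof (rule that[OF _ M _ G])
    show "Transitive (elts M)" unfolding Transitive_def M using G by auto
    show "inj_on G Y" using G_inj by (auto simp: inj_on_def)
  qed
qed

lemma ex_Ord_eqpoll:
  fixes A :: "'v::zfc set"
  assumes "small A"
  obtains \<beta> :: 'v where "Ord \<beta>" "elts \<beta> \<approx> A"
proof -
  obtain r where r: "well_order_on A r" using well_order_on[of A] by (rule exE)
  define R where "R = r - Id"
  have R: "wf R" "trans R" "total_on A R" "R \<subseteq> A \<times> A"
  proof -
    show "wf R" using r by (simp add: well_order_on_def R_def)
    show "trans R" using r
      by (auto simp: well_order_on_def linear_order_on_def partial_order_on_def preorder_on_def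
          R_def intro: trans_diff_Id)
    show "total_on A R" using r
      by (auto simp: well_order_on_def linear_order_on_def R_def total_on_def)
    show "R \<subseteq> A \<times> A" using r
      by (auto simp: well_order_on_def linear_order_on_def partial_order_on_def preorder_on_def
          refl_on_def R_def)
  qed
  have "small {y. (y, x) \<in> R}" for x
    using R(4) by (intro small_subset[OF assms]) auto
  note coll = elts_collapse[OF R(1) this]
  have tr: "Transitive (elts (collapse R x))" for x
    using R(2) unfolding Transitive_def coll by (auto simp: coll dest: transD)
  define \<beta> where "\<beta> = set_of (collapse R ` A)"
  have el: "elts \<beta> = collapse R ` A" using assms by (simp add: \<beta>_def small_image)
  have "Ord \<beta>"
    unfolding Ord_def el using tr R(4) by (auto simp: Transitive_def coll)
  have "inj_on (collapse R) A"
  proof (rule inj_onI, rule ccontr)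
    fix a b assume ab: "a \<in> A" "b \<in> A" "collapse R a = collapse R b" "a \<noteq> b"
    then have "(a, b) \<in> R \<or> (b, a) \<in> R" using R(3) by (auto simp: total_on_def)
    then have "collapse R a \<in> elts (collapse R b) \<or> collapse R b \<in> elts (collapse R a)"
      by (auto simp: coll)
    then show False using ab by simp
  qed
  then have "elts \<beta> \<approx> A" unfolding el by (rule inj_on_image_eqpoll_self)
  with \<open>Ord \<beta>\<close> show thesis by (rule that)
qed

text \<open>Hartogs' argument: the power set of \<open>A\<close> has the size of some ordinal, so some ordinal does not
  inject into \<open>A\<close>, and the least such ordinal is a cardinal because all smaller ones do inject.\<close>

lemma ex_Card_above:
  fixes A :: "'v::zfc set"
  assumes "small A"
  obtains \<theta> :: 'v where "Card \<theta>" "\<not> elts \<theta> \<lesssim> A"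
proof -
  obtain x where x: "elts x = A" using assms unfolding small_def by blast
  obtain \<beta> :: 'v where \<beta>: "Ord \<beta>" "elts \<beta> \<approx> {v. elts v \<subseteq> elts x}"
    using ex_Ord_eqpoll[OF small_powerset] .
  have "inj_on set_of (Pow A)"
    by (rule inj_on_inverseI[where g = elts]) (simp add: small_subset[OF assms])
  moreover have "set_of ` Pow A \<subseteq> {v. elts v \<subseteq> elts x}"
    using elts_set_of[OF small_subset[OF assms]] x by auto
  ultimately have "Pow A \<lesssim> {v. elts v \<subseteq> elts x}" unfolding lepoll_def by blast
  then have "Pow A \<lesssim> elts \<beta>" using \<beta>(2) eqpoll_sym lepoll_trans2 by blast
  then have "\<not> elts \<beta> \<lesssim> A"
    using lesspoll_Pow_self[of A] lepoll_trans lesspoll_trans2 lesspoll_not_refl by blast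
  from least_Ord[of "\<lambda>\<beta>. \<not> elts \<beta> \<lesssim> A", OF this \<beta>(1)] obtain \<theta> :: 'v
    where \<theta>: "\<not> elts \<theta> \<lesssim> A" "Ord \<theta>"
      "\<And>\<gamma>. \<not> elts \<gamma> \<lesssim> A \<Longrightarrow> Ord \<gamma> \<Longrightarrow> elts \<theta> \<subseteq> elts \<gamma>" by metis
  have "\<not> elts \<gamma> \<approx> elts \<theta>" if "\<gamma> \<in> elts \<theta>" for \<gamma>
  proof -
    have "elts \<gamma> \<lesssim> A"
      using \<theta>(3)[of \<gamma>] Ord_in_Ord[OF \<theta>(2) that] that mem_irrefl by blast
    then show ?thesis using \<theta>(1) by (meson eqpoll_sym lepoll_trans1)
  qed
  then have "Card \<theta>" using \<theta>(2) by (simp add: Card_def)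
  with \<theta>(1) show thesis using that by blast
qed

text \<open>Comparability of cardinalities, reduced to comparability of ordinals by giving \<open>A\<close> the size of
  an ordinal.\<close>

lemma Card_not_lepoll:
  fixes A :: "'v::zfc set" and \<theta> :: 'v
  assumes "Card \<theta>" "small A" "\<not> elts \<theta> \<lesssim> A"
  shows "A \<prec> elts \<theta>"
proof -
  obtain \<beta> :: 'v where \<beta>: "Ord \<beta>" "elts \<beta> \<approx> A" using ex_Ord_eqpoll[OF assms(2)] .
  have "\<not> elts \<theta> \<subseteq> elts \<beta>"
    using assms(3) \<beta>(2) by (meson lepoll_trans2 subset_imp_lepoll)
  then have "\<beta> \<in> elts \<theta>" using Ord_not_mem_iff Card_Ord assms(1) \<beta>(1) by blast
  then show ?thesis
    using Card_mem_lesspoll[OF assms(1)] \<beta>(2) by (meson eq_lesspoll_trans eqpoll_sym)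
qed

section \<open>Hereditary cardinality\<close>

lemma trans_closure_least: "elts x \<subseteq> T \<Longrightarrow> Transitive T \<Longrightarrow> trans_closure x \<subseteq> T"
  by (auto simp: trans_closure_def)

lemma Transitive_trans_closure: "Transitive (trans_closure x)"
  unfolding trans_closure_def Transitive_def by blast

lemma elts_subset_trans_closure: "elts x \<subseteq> trans_closure x"
  by (auto simp: trans_closure_def)

lemma HsetI: "elts x \<subseteq> T \<Longrightarrow> Transitive T \<Longrightarrow> T \<prec> elts \<theta> \<Longrightarrow> x \<in> Hset \<theta>"
  unfolding Hset_def
  by (simp add: lesspoll_trans1[OF subset_imp_lepoll[OF trans_closure_least]])

lemma Hset_subset:
  assumes "x \<in> Hset \<theta>" "elts y \<subseteq> elts x"
  shows "y \<in> Hset \<theta>"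
  using assms HsetI[OF _ Transitive_trans_closure[of x], of y] elts_subset_trans_closure[of x]
  by (auto simp: Hset_def)

lemma Transitive_Hset: "Transitive (Hset \<theta>)"
  unfolding Transitive_def
proof (intro ballI subsetI)
  fix x y assume x: "x \<in> Hset \<theta>" and y: "y \<in> elts x"
  then have "elts y \<subseteq> trans_closure x"
    using elts_subset_trans_closure[of x] Transitive_trans_closure[of x]
    by (auto simp: Transitive_def)
  then show "y \<in> Hset \<theta>"
    using HsetI[OF _ Transitive_trans_closure[of x]] x by (auto simp: Hset_def)
qed


section \<open>Elementary embeddings\<close>

definition Forall :: "nat \<Rightarrow> fm \<Rightarrow> fm" where "Forall i p = Neg (Ex i (Neg p))"
definition Imp :: "fm \<Rightarrow> fm \<Rightarrow> fm" where "Imp p q = Neg (Conj p (Neg q))"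
definition Disj :: "fm \<Rightarrow> fm \<Rightarrow> fm" where "Disj p q = Neg (Conj (Neg p) (Neg q))"
definition Iff :: "fm \<Rightarrow> fm \<Rightarrow> fm" where "Iff p q = Conj (Imp p q) (Imp q p)"

lemma sat_defined_connectives [simp]:
  "sat M (Forall i p) s \<longleftrightarrow> (\<forall>a\<in>M. sat M p (s(i := a)))"
  "sat M (Imp p q) s \<longleftrightarrow> (sat M p s \<longrightarrow> sat M q s)"
  "sat M (Disj p q) s \<longleftrightarrow> sat M p s \<or> sat M q s"
  "sat M (Iff p q) s \<longleftrightarrow> (sat M p s \<longleftrightarrow> sat M q s)"
  by (auto simp: Forall_def Imp_def Disj_def Iff_def)

text \<open>Says that the pair of the values of variables \<open>i\<close> and \<open>k\<close> is an element of the value of \<open>f\<close>.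
  The variables 9 and 10 are bound in it, so it is to be used with smaller variables.\<close>

definition pair_fm :: "nat \<Rightarrow> nat \<Rightarrow> nat \<Rightarrow> fm" where
  "pair_fm i k f = Ex 9 (Conj (Mem 9 f) (Forall 10 (Iff (Mem 10 9) (Disj (Eq 10 i) (Eq 10 k)))))"

definition pair_in :: "'v::zfc \<Rightarrow> 'v \<Rightarrow> 'v \<Rightarrow> bool" where
  "pair_in a b F \<longleftrightarrow> (\<exists>c\<in>elts F. elts c = {a, b})"

lemma sat_pair_fm [simp]:
  assumes "Transitive M" "s i \<in> M" "s k \<in> M" "s f \<in> M" "i < 9" "k < 9" "f < 9"
  shows "sat M (pair_fm i k f) s \<longleftrightarrow> pair_in (s i) (s k) (s f)"
proof -
  have "(\<forall>z\<in>M. z \<in> elts c \<longleftrightarrow> z = s i \<or> z = s k) \<longleftrightarrow> elts c = {s i, s k}" if "c \<in> M" for c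
    using assms(1-3) that unfolding Transitive_def by blast
  moreover have "c \<in> M" if "c \<in> elts (s f)" for c
    using assms(1,4) that unfolding Transitive_def by blast
  ultimately show ?thesis
    using assms(5-7) unfolding pair_fm_def pair_in_def by (simp cong: conj_cong) blast
qed

text \<open>The assignment of the listed parameters to the variables 0, 1, and so on. The last parameter is
  repeated forever, so that all values come from the list; elementarity is only about assignments
  with all values in the domain.\<close>

fun params :: "'v list \<Rightarrow> nat \<Rightarrow> 'v" where
  "params (x # xs) n = (case n of 0 \<Rightarrow> x | Suc m \<Rightarrow> if xs = [] then x else params xs m)"
| "params [] n = undefined"

lemma params_range: "xs \<noteq> [] \<Longrightarrow> range (params xs) \<subseteq> set xs"
proof (induction xs)
  case (Cons x xs)
  have "params (x # xs) n \<in> set (x # xs)" for n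
    using Cons.IH by (cases n) auto
  then show ?case by auto
qed simp

lemma comp_params: "xs \<noteq> [] \<Longrightarrow> j \<circ> params xs = params (map j xs)"
proof (induction xs)
  case (Cons x xs)
  have "j (params (x # xs) n) = params (map j (x # xs)) n" for n
    using Cons.IH by (cases n) (auto simp: fun_eq_iff)
  then show ?case by auto
qed simp

lemma elementary_sat:
  assumes "elementary M N j" "set xs \<subseteq> M" "xs \<noteq> []"
  shows "sat M p (params xs) \<longleftrightarrow> sat N p (params (map j xs))"
  using assms params_range[of xs] unfolding elementary_def
  by (metis comp_params subset_trans)

lemma params_numeral [simp]:
  "params (x # xs) 0 = x"
  "params (x # y # xs) (Suc n) = params (y # xs) n"
  "params (x # y # xs) (numeral k) = params (y # xs) (pred_numeral k)"
  by (simp_all add: numeral_eq_Suc)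

locale transitive_embedding =
  fixes M N :: "'v::zfc set" and j :: "'v \<Rightarrow> 'v"
  assumes elem: "elementary M N j" and trM: "Transitive M" and trN: "Transitive N"
begin

lemma M_trans: "x \<in> elts y \<Longrightarrow> y \<in> M \<Longrightarrow> x \<in> M"
  using trM by (auto simp: Transitive_def)

lemma N_trans: "x \<in> elts y \<Longrightarrow> y \<in> N \<Longrightarrow> x \<in> N"
  using trN by (auto simp: Transitive_def)

lemma j_in: "x \<in> M \<Longrightarrow> j x \<in> N"
  using elem by (auto simp: elementary_def)

lemma transfer:
  "set (x # xs) \<subseteq> M \<Longrightarrow> sat M p (params (x # xs)) \<longleftrightarrow> sat N p (params (j x # map j xs))"
  using elementary_sat[OF elem, of "x # xs" p] by simp

lemma j_mem: "a \<in> M \<Longrightarrow> b \<in> M \<Longrightarrow> j a \<in> elts (j b) \<longleftrightarrow> a \<in> elts b"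
  using transfer[of a "[b]" "Mem 0 1"] by simp

lemma ball_M: "a \<in> M \<Longrightarrow> (\<forall>x\<in>M. x \<in> elts a \<longrightarrow> P x) \<longleftrightarrow> (\<forall>x\<in>elts a. P x)"
  using M_trans by blast

lemma ball_N: "a \<in> N \<Longrightarrow> (\<forall>x\<in>N. x \<in> elts a \<longrightarrow> P x) \<longleftrightarrow> (\<forall>x\<in>elts a. P x)"
  using N_trans by blast

lemma j_subset: "a \<in> M \<Longrightarrow> b \<in> M \<Longrightarrow> elts (j a) \<subseteq> elts (j b) \<longleftrightarrow> elts a \<subseteq> elts b"
  using transfer[of a "[b]" "Forall 4 (Imp (Mem 4 0) (Mem 4 1))"]
  unfolding subset_eq by (simp add: ball_M ball_N j_in)

lemma j_Ord:
  assumes "a \<in> M" "Ord a"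
  shows "Ord (j a)"
proof -
  define p where "p = Conj (Forall 4 (Imp (Mem 4 0) (Forall 5 (Imp (Mem 5 4) (Mem 5 0)))))
    (Forall 6 (Imp (Mem 6 0) (Forall 4 (Imp (Mem 4 6) (Forall 5 (Imp (Mem 5 4) (Mem 5 6)))))))"
  have p: "sat K p (params [b]) \<longleftrightarrow>
      (\<forall>x\<in>K. x \<in> elts b \<longrightarrow> (\<forall>y\<in>K. y \<in> elts x \<longrightarrow> y \<in> elts b)) \<and>
      (\<forall>x\<in>K. x \<in> elts b \<longrightarrow> (\<forall>y\<in>K. y \<in> elts x \<longrightarrow> (\<forall>z\<in>K. z \<in> elts y \<longrightarrow> z \<in> elts x)))"
    for K :: "'v set" and b by (simp add: p_def)
  have "\<And>x y. x \<in> elts a \<Longrightarrow> y \<in> elts x \<Longrightarrow> y \<in> elts a"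
    "\<And>x y z. x \<in> elts a \<Longrightarrow> y \<in> elts x \<Longrightarrow> z \<in> elts y \<Longrightarrow> z \<in> elts x"
    using Ord_trans[OF assms(2)] Ord_trans[OF Ord_in_Ord[OF assms(2)]] by blast+
  then have "sat M p (params [a])" unfolding p by blast
  then have "sat N p (params [j a])" using transfer[of a "[]" p] assms(1) by simp
  then have N: "\<forall>x\<in>N. x \<in> elts (j a) \<longrightarrow> (\<forall>y\<in>N. y \<in> elts x \<longrightarrow> y \<in> elts (j a))"
    "\<forall>x\<in>N. x \<in> elts (j a) \<longrightarrow> (\<forall>y\<in>N. y \<in> elts x \<longrightarrow> (\<forall>z\<in>N. z \<in> elts y \<longrightarrow> z \<in> elts x))"
    unfolding p by blast+
  have "j a \<in> N" using j_in assms(1) .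
  show ?thesis
    unfolding Ord_def Transitive_def
  proof (intro conjI ballI subsetI)
    fix x y assume x: "x \<in> elts (j a)" "y \<in> elts x"
    then have xy: "x \<in> N" "y \<in> N" using N_trans \<open>j a \<in> N\<close> by blast+
    then show "y \<in> elts (j a)" using N(1) x by blast
    fix z assume "z \<in> elts y"
    then show "z \<in> elts x" using N(2) x xy N_trans by blast
  qed
qed

text \<open>If \<open>j a \<in> a\<close>, then \<open>j (j a) \<in> j a\<close>, so \<open>j a\<close> is a smaller set with the same property.\<close>

lemma not_j_mem: "a \<in> M \<Longrightarrow> j a \<notin> elts a"
  using foundation
proof (induction a rule: wf_induct_rule)
  case (less a)
  then show ?case using M_trans[of "j a" a] j_mem[of "j a" a] by auto
qed

lemma j_fixes_below:
  assumes "\<And>\<beta>. moves M j \<beta> \<Longrightarrow> elts \<mu> \<subseteq> elts \<beta>" "\<mu> \<in> M" "Ord \<mu>" "\<xi> \<in> elts \<mu>"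
  shows "j \<xi> = \<xi>"
proof -
  have \<xi>: "\<xi> \<in> M" "Ord \<xi>" using assms M_trans Ord_in_Ord by auto
  have "\<not> moves M j \<xi>" using assms(1,4) mem_irrefl by blast
  then show ?thesis
    using \<xi> not_j_mem[of \<xi>] Ord_linear[OF \<xi>(2) j_Ord[OF \<xi>]] by (auto simp: moves_def)
qed

end

text \<open>Models that contain all subsets of their elements, such as \<open>H(\<theta>)\<close>, satisfy every instance of
  Separation, and elementarity hands these instances down to \<open>M\<close>.\<close>

locale full_embedding = transitive_embedding M N j for M N :: "'v::zfc set" and j +
  assumes N_subset: "x \<in> N \<Longrightarrow> elts y \<subseteq> elts x \<Longrightarrow> y \<in> N"
begin

text \<open>The witness for an instance of Separation in \<open>M\<close> is moved by \<open>j\<close> to the set that the same formula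
  defines in \<open>N\<close>. Variable 4 stands for the element that is tested and variable 5 for the new
  set, hence \<open>p\<close> must not depend on variable 5.\<close>

lemma separation_in_M:
  assumes inv: "\<And>(K::'v set) s v. sat K p (s(5 := v)) = sat K p s"
    and xs: "set (a # xs) \<subseteq> M"
  obtains d where "d \<in> M"
    "elts d = {x \<in> elts a. sat M p ((params (a # xs))(4 := x))}"
    "elts (j d) = {x \<in> elts (j a). sat N p ((params (j a # map j xs))(4 := x))}"
proof -
  define q where "q = Forall 4 (Iff (Mem 4 5) (Conj (Mem 4 0) p))"
  have q: "sat K q (s(5 := d)) \<longleftrightarrow> elts d = {x \<in> elts (s 0). sat K p (s(4 := x))}"
    if "Transitive K" "s 0 \<in> K" "d \<in> K" for K :: "'v set" and s d
  proof -
    have "sat K p (s(5 := d, 4 := x)) = sat K p (s(4 := x))" for x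
      using inv[of K "s(4 := x)" d] by (simp add: fun_upd_twist)
    moreover have "elts d \<subseteq> K" "elts (s 0) \<subseteq> K" using that by (auto simp: Transitive_def)
    ultimately show ?thesis unfolding q_def by auto
  qed
  let ?s = "params (a # xs)" and ?t = "params (j a # map j xs)"
  have st: "j \<circ> ?s = ?t" using comp_params[of "a # xs" j] by simp
  obtain e where e: "elts e = {x \<in> elts (j a). sat N p (?t(4 := x))}"
    using separation[of "j a" "\<lambda>x. sat N p (?t(4 := x))"] by blast
  have "j a \<in> N" using j_in xs by simp
  then have "e \<in> N" using e N_subset by blast
  then have "sat N (Ex 5 q) ?t"
    using q[OF trN, of ?t] \<open>j a \<in> N\<close> e by auto
  then have "sat M (Ex 5 q) ?s" using transfer[OF xs] by blast
  then obtain d where d: "d \<in> M" "sat M q (?s(5 := d))" by auto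
  have "range ?s \<subseteq> M" using params_range[of "a # xs"] xs by (metis list.discI subset_trans)
  then have "range (?s(5 := d)) \<subseteq> M" using d(1) by (simp add: image_subset_iff)
  then have "sat N q (j \<circ> (?s(5 := d)))"
    using elem d unfolding elementary_def by blast
  moreover have "j \<circ> (?s(5 := d)) = ?t(5 := j d)"
    unfolding st[symmetric] by (simp add: fun_upd_comp)
  ultimately have "sat N q (?t(5 := j d))" by simp
  then have "elts (j d) = {x \<in> elts (j a). sat N p (?t(4 := x))}"
    using q[OF trN, of ?t "j d"] \<open>j a \<in> N\<close> j_in d by simp
  moreover have "elts d = {x \<in> elts a. sat M p (?s(4 := x))}"
    using q[OF trM, of ?s d] d xs by simp
  ultimately show thesis using d that by blast
qed

lemma difference_in_M:
  assumes "a \<in> M" "b \<in> M"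
  obtains d where "d \<in> M" "elts d = elts a - elts b" "elts (j d) = elts (j a) - elts (j b)"
proof -
  obtain d where "d \<in> M"
    "elts d = {x \<in> elts a. sat M (Neg (Mem 4 1)) ((params [a, b])(4 := x))}"
    "elts (j d) = {x \<in> elts (j a). sat N (Neg (Mem 4 1)) ((params (j a # map j [b]))(4 := x))}"
    using separation_in_M[of "Neg (Mem 4 1)" a "[b]"] assms by auto
  then show thesis by (intro that[of d]) auto
qed

end

lemma Hset_full_embedding:
  assumes "elementary (elts M) (Hset \<theta>) j" "Transitive (elts M)"
  shows "full_embedding (elts M) (Hset \<theta>) j"
  using assms Transitive_Hset Hset_subset by unfold_locales auto

lemma least_moved:
  assumes "nontrivial M j"
  shows "moves M j (crit M j)" "moves M j \<beta> \<Longrightarrow> elts (crit M j) \<subseteq> elts \<beta>"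
proof -
  obtain \<alpha> where "moves M j \<alpha>" "Ord \<alpha>"
    using assms by (auto simp: nontrivial_def moves_def)
  then obtain \<gamma> where "moves M j \<gamma>" "\<And>\<beta>. moves M j \<beta> \<Longrightarrow> Ord \<beta> \<Longrightarrow> elts \<gamma> \<subseteq> elts \<beta>"
    by (rule least_Ord) blast
  then have "\<exists>!\<alpha>. moves M j \<alpha> \<and> (\<forall>\<beta>. moves M j \<beta> \<longrightarrow> elts \<alpha> \<subseteq> elts \<beta>)"
    by (intro ex1I[of _ \<gamma>]) (auto simp: moves_def intro!: elts_eqI)
  from theI'[OF this] show "moves M j (crit M j)" "moves M j \<beta> \<Longrightarrow> elts (crit M j) \<subseteq> elts \<beta>"
    by (auto simp: crit_def)
qed

lemma crit_eqI:
  assumes "moves M j \<alpha>" "\<And>\<beta>. moves M j \<beta> \<Longrightarrow> elts \<alpha> \<subseteq> elts \<beta>"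
  shows "crit M j = \<alpha>"
  unfolding crit_def
  by (rule the_equality) (use assms in \<open>auto intro!: elts_eqI\<close>)


section \<open>From small embeddings to measures\<close>

text \<open>The model \<open>N\<close> plays the role of \<open>H(\<theta>)\<close> and \<open>\<mu>\<close> that of the critical point. That \<open>N\<close> contains
  every set of subsets of \<open>\<kappa>\<close> is what turns statements that are true in \<open>N\<close> about \<open>j D\<close> into true
  statements.\<close>

locale derived_measure = full_embedding M N j for M N :: "'v::zfc set" and j +
  fixes \<kappa> \<mu> D :: 'v
  assumes Card_\<kappa>: "Card \<kappa>"
    and moved: "moves M j \<mu>" and least: "\<And>\<beta>. moves M j \<beta> \<Longrightarrow> elts \<mu> \<subseteq> elts \<beta>"
    and j_\<mu>: "j \<mu> = \<kappa>"
    and D_M: "D \<in> M"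
    and elts_D: "elts D = {A \<in> M. elts A \<subseteq> elts \<mu> \<and> \<mu> \<in> elts (j A)}"
    and N_PP: "\<And>x. elts x \<subseteq> {v. elts v \<subseteq> elts \<kappa>} \<Longrightarrow> x \<in> N"
begin

lemma \<mu>_M: "\<mu> \<in> M" and Ord_\<mu>: "Ord \<mu>" and \<mu>_\<kappa>: "\<mu> \<in> elts \<kappa>"
  using moved j_\<mu> by (auto simp: moves_def)

lemma Ord_\<kappa>: "Ord \<kappa>"
  using Card_\<kappa> Card_Ord by blast

lemma \<kappa>_N: "\<kappa> \<in> N"
  using j_in[OF \<mu>_M] j_\<mu> by simp

lemma jD_N: "j D \<in> N"
  using j_in D_M by simp

lemma fixed: "\<xi> \<in> elts \<mu> \<Longrightarrow> j \<xi> = \<xi>"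
  using j_fixes_below[OF least \<mu>_M Ord_\<mu>] .

lemma subset_N: "elts A \<subseteq> elts \<kappa> \<Longrightarrow> A \<in> N"
  using N_subset \<kappa>_N by blast

lemma \<kappa>_in: "\<kappa> \<in> elts (j D)"
proof -
  have "\<mu> \<in> elts D" using elts_D \<mu>_M \<mu>_\<kappa> j_\<mu> by auto
  then show ?thesis using j_mem[OF \<mu>_M D_M] j_\<mu> by simp
qed

text \<open>In \<open>M\<close>: from \<open>A \<subseteq> B \<subseteq> \<mu>\<close> and \<open>\<mu> \<in> j A\<close> follows \<open>\<mu> \<in> j A \<subseteq> j B\<close>.\<close>

lemma upward:
  assumes "A \<in> elts (j D)" "elts A \<subseteq> elts B" "elts B \<subseteq> elts \<kappa>"
  shows "B \<in> elts (j D)"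
proof -
  define p where "p = Forall 4 (Imp (Mem 4 0) (Forall 5
    (Imp (Forall 6 (Imp (Mem 6 4) (Mem 6 5))) (Imp (Forall 6 (Imp (Mem 6 5) (Mem 6 1))) (Mem 5 0)))))"
  have p: "sat K p (params [d, l]) \<longleftrightarrow>
      (\<forall>A\<in>K. A \<in> elts d \<longrightarrow> (\<forall>B\<in>K. elts A \<subseteq> elts B \<longrightarrow> elts B \<subseteq> elts l \<longrightarrow> B \<in> elts d))"
    if "Transitive K" for K :: "'v set" and d l
  proof -
    have "(\<forall>x\<in>K. x \<in> elts a \<longrightarrow> x \<in> elts b) \<longleftrightarrow> elts a \<subseteq> elts b" if "a \<in> K" for a b
      using that \<open>Transitive K\<close> unfolding Transitive_def by blast
    then show ?thesis by (simp add: p_def)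
  qed
  have "B \<in> elts D" if "A \<in> M" "A \<in> elts D" "B \<in> M" "elts A \<subseteq> elts B" "elts B \<subseteq> elts \<mu>" for A B
    using that j_subset[of A B] elts_D by auto
  then have "sat M p (params [D, \<mu>])" unfolding p[OF trM] by blast
  then have "sat N p (params [j D, \<kappa>])" using transfer[of D "[\<mu>]" p] D_M \<mu>_M j_\<mu> by simp
  then show ?thesis
    unfolding p[OF trN] using assms subset_N N_trans[OF assms(1) jD_N] by blast
qed

text \<open>In \<open>M\<close>: since \<open>\<mu> \<in> j \<mu>\<close> and \<open>j\<close> commutes with differences, \<open>\<mu>\<close> is in \<open>j A\<close> or in
  \<open>j (\<mu> - A)\<close>. The formula only asks for a member of the filter disjoint from \<open>A\<close>; upward closure
  does the rest.\<close>

lemma complement: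
  assumes "elts A \<subseteq> elts \<kappa>" "A \<notin> elts (j D)" "elts B = elts \<kappa> - elts A"
  shows "B \<in> elts (j D)"
proof -
  define p where "p = Forall 4 (Disj (Mem 4 0) (Disj (Ex 5 (Conj (Mem 5 4) (Neg (Mem 5 1))))
    (Ex 5 (Conj (Mem 5 0) (Forall 6 (Imp (Mem 6 5) (Conj (Mem 6 1) (Neg (Mem 6 4)))))))))"
  have p: "sat K p (params [d, l]) \<longleftrightarrow>
      (\<forall>A\<in>K. A \<in> elts d \<or> \<not> elts A \<subseteq> elts l \<or> (\<exists>B\<in>K. B \<in> elts d \<and> elts B \<subseteq> elts l - elts A))"
    if "Transitive K" for K :: "'v set" and d l
  proof -
    have 1: "(\<exists>x\<in>K. x \<in> elts a \<and> x \<notin> elts b) \<longleftrightarrow> \<not> elts a \<subseteq> elts b" if "a \<in> K" for a b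
      using that \<open>Transitive K\<close> unfolding Transitive_def by blast
    have 2: "(\<forall>x\<in>K. x \<in> elts a \<longrightarrow> x \<in> elts b \<and> x \<notin> elts c) \<longleftrightarrow> elts a \<subseteq> elts b - elts c"
      if "a \<in> K" for a b c
      using that \<open>Transitive K\<close> unfolding Transitive_def by blast
    show ?thesis by (simp add: p_def 1 2 cong: ball_cong bex_cong)
  qed
  have "\<exists>B\<in>M. B \<in> elts D \<and> elts B \<subseteq> elts \<mu> - elts A"
    if A: "A \<in> M" "A \<notin> elts D" "elts A \<subseteq> elts \<mu>" for A
  proof -
    obtain B where B: "B \<in> M" "elts B = elts \<mu> - elts A" "elts (j B) = elts (j \<mu>) - elts (j A)"
      using difference_in_M[OF \<mu>_M A(1)] .
    have "\<mu> \<notin> elts (j A)" using A elts_D by simp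
    then have "B \<in> elts D" using B \<mu>_\<kappa> j_\<mu> elts_D by simp
    then show ?thesis using B by blast
  qed
  then have "sat M p (params [D, \<mu>])" unfolding p[OF trM] by blast
  then have "sat N p (params [j D, \<kappa>])" using transfer[of D "[\<mu>]" p] D_M \<mu>_M j_\<mu> by simp
  then obtain B' where "B' \<in> elts (j D)" "elts B' \<subseteq> elts \<kappa> - elts A"
    unfolding p[OF trN] using assms(1,2) subset_N by blast
  then show ?thesis using upward assms(3) by auto
qed

text \<open>In \<open>M\<close>: if \<open>A\<close> had at most the one element \<open>\<xi> < \<mu>\<close>, then \<open>\<mu> \<in> j A \<subseteq> {j \<xi>} = {\<xi>}\<close>. This covers
  both that the empty set is not in the filter and that the filter is not principal.\<close>

lemma two_points:
  assumes "A \<in> elts (j D)" "x \<in> elts \<kappa>"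
  shows "\<exists>y\<in>elts A. y \<noteq> x"
proof -
  define p where "p = Forall 4 (Imp (Mem 4 0) (Forall 5 (Imp (Mem 5 1)
    (Ex 6 (Conj (Mem 6 4) (Neg (Eq 6 5)))))))"
  have p: "sat K p (params [d, l]) \<longleftrightarrow>
      (\<forall>A\<in>K. A \<in> elts d \<longrightarrow> (\<forall>x\<in>K. x \<in> elts l \<longrightarrow> (\<exists>y\<in>elts A. y \<noteq> x)))"
    if "Transitive K" for K :: "'v set" and d l
  proof -
    have "(\<exists>y\<in>K. y \<in> elts a \<and> y \<noteq> x) \<longleftrightarrow> (\<exists>y\<in>elts a. y \<noteq> x)" if "a \<in> K" for a x
      using that \<open>Transitive K\<close> unfolding Transitive_def by blast
    then show ?thesis by (simp add: p_def)
  qed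
  have "\<exists>y\<in>elts A. y \<noteq> \<xi>" if A: "A \<in> elts D" and \<xi>: "\<xi> \<in> elts \<mu>" for A \<xi>
  proof (rule ccontr)
    assume no: "\<not> ?thesis"
    have AM: "A \<in> M" "\<xi> \<in> M" using M_trans[OF A D_M] M_trans[OF \<xi> \<mu>_M] .
    define q where "q = Forall 4 (Imp (Mem 4 0) (Eq 4 1))"
    have q: "sat K q (params [a, x]) \<longleftrightarrow> (\<forall>y\<in>K. y \<in> elts a \<longrightarrow> y = x)" for K :: "'v set" and a x
      by (simp add: q_def)
    have "sat M q (params [A, \<xi>])" unfolding q using no by blast
    then have "sat N q (params [j A, j \<xi>])" using transfer[of A "[\<xi>]" q] AM by simp
    then have "\<mu> = \<xi>"
      unfolding q fixed[OF \<xi>] using A elts_D \<mu>_\<kappa> N_trans \<kappa>_N by blast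
    then show False using \<xi> by simp
  qed
  then have "sat M p (params [D, \<mu>])" unfolding p[OF trM] by blast
  then have "sat N p (params [j D, \<kappa>])" using transfer[of D "[\<mu>]" p] D_M \<mu>_M j_\<mu> by simp
  then show ?thesis
    unfolding p[OF trN] using assms N_trans jD_N \<kappa>_N by blast
qed

text \<open>Completeness, with the sequence of sets given by the code \<open>F\<close>: the \<open>\<xi>\<close>-th set consists of the
  \<open>\<alpha>\<close> that are paired with \<open>\<xi>\<close> in \<open>F\<close>, and it has to contain a member of the filter only up to
  points below \<open>\<nu>\<close>.
  In \<open>M\<close>, let \<open>B\<close> be the intersection of these sets. As \<open>j\<close> fixes \<open>\<nu>\<close> and all \<open>\<xi> < \<nu>\<close>, the set
  \<open>j B\<close> is the intersection of the sequence coded by \<open>j F\<close>, of the same length. Each hypothesis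
  \<open>A \<in> D\<close> for \<open>\<xi>\<close> gives \<open>\<mu> \<in> j A\<close>, hence \<open>\<mu>\<close> is paired with \<open>\<xi>\<close> in \<open>j F\<close>, because
  \<open>\<mu>\<close> is not below \<open>j \<nu> = \<nu>\<close>. So \<open>\<mu> \<in> j B\<close>, that is, \<open>B \<in> D\<close>.\<close>

lemma pair_complete:
  assumes "\<nu> \<in> elts \<kappa>" "F \<in> N"
    and "\<And>\<xi>. \<xi> \<in> elts \<nu> \<Longrightarrow> \<exists>A\<in>elts (j D). \<forall>\<alpha>\<in>elts A. \<alpha> \<in> elts \<nu> \<or> pair_in \<xi> \<alpha> F"
  shows "\<exists>A\<in>elts (j D). \<forall>\<alpha>\<in>elts A. \<forall>\<xi>\<in>elts \<nu>. pair_in \<xi> \<alpha> F"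
proof -
  define p where "p = Forall 4 (Imp (Mem 4 1) (Forall 5 (Imp
    (Forall 6 (Imp (Mem 6 4) (Ex 7 (Conj (Mem 7 0)
      (Forall 8 (Imp (Mem 8 7) (Disj (Mem 8 4) (pair_fm 6 8 5))))))))
    (Ex 7 (Conj (Mem 7 0) (Forall 8 (Imp (Mem 8 7) (Forall 6 (Imp (Mem 6 4) (pair_fm 6 8 5))))))))))"
  have p: "sat K p (params [d, l]) \<longleftrightarrow>
      (\<forall>\<nu>\<in>elts l. \<forall>F\<in>K.
        (\<forall>\<xi>\<in>elts \<nu>. \<exists>A\<in>elts d. \<forall>\<alpha>\<in>elts A. \<alpha> \<in> elts \<nu> \<or> pair_in \<xi> \<alpha> F) \<longrightarrow>
        (\<exists>A\<in>elts d. \<forall>\<alpha>\<in>elts A. \<forall>\<xi>\<in>elts \<nu>. pair_in \<xi> \<alpha> F))"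
    if tr: "Transitive K" and dl: "d \<in> K" "l \<in> K" for K :: "'v set" and d l
  proof -
    have 1: "(\<forall>x\<in>K. x \<in> elts a \<longrightarrow> P x) \<longleftrightarrow> (\<forall>x\<in>elts a. P x)" if "a \<in> K" for a P
      using that tr unfolding Transitive_def by blast
    have 2: "(\<exists>x\<in>K. x \<in> elts a \<and> P x) \<longleftrightarrow> (\<exists>x\<in>elts a. P x)" if "a \<in> K" for a P
      using that tr unfolding Transitive_def by blast
    have 3: "x \<in> K" if "x \<in> elts a" "a \<in> K" for x a
      using that tr unfolding Transitive_def by blast
    show ?thesis using dl by (simp add: p_def tr 1 2 3 cong: ball_cong bex_cong)
  qed
  have "\<exists>A\<in>elts D. \<forall>\<alpha>\<in>elts A. \<forall>\<xi>\<in>elts \<nu>. pair_in \<xi> \<alpha> F"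
    if \<nu>: "\<nu> \<in> elts \<mu>" and F: "F \<in> M"
      and hyp: "\<forall>\<xi>\<in>elts \<nu>. \<exists>A\<in>elts D. \<forall>\<alpha>\<in>elts A. \<alpha> \<in> elts \<nu> \<or> pair_in \<xi> \<alpha> F" for \<nu> F
  proof -
    have \<nu>M: "\<nu> \<in> M" using M_trans[OF \<nu> \<mu>_M] .
    define q where "q = Forall 6 (Imp (Mem 6 1) (pair_fm 6 4 2))"
    have q: "sat K q ((params [l, n, f])(4 := x)) \<longleftrightarrow> (\<forall>\<xi>\<in>elts n. pair_in \<xi> x f)"
      if "Transitive K" "l \<in> K" "n \<in> K" "f \<in> K" "x \<in> K" for K :: "'v set" and l n f x
      using that by (simp add: q_def) (auto simp: Transitive_def)
    have inv: "sat K q (s(5 := v)) = sat K q s" for K :: "'v set" and s v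
      by (simp add: q_def pair_fm_def)
    obtain B where B: "B \<in> M"
      "elts B = {x \<in> elts \<mu>. sat M q ((params [\<mu>, \<nu>, F])(4 := x))}"
      "elts (j B) = {x \<in> elts (j \<mu>). sat N q ((params (j \<mu> # map j [\<nu>, F]))(4 := x))}"
      using separation_in_M[OF inv, of \<mu> "[\<nu>, F]"] \<mu>_M \<nu>M F by auto
    have jN: "j \<nu> \<in> N" "j F \<in> N" using j_in \<nu>M F by auto
    have "pair_in \<xi> \<mu> (j F)" if \<xi>: "\<xi> \<in> elts \<nu>" for \<xi>
    proof -
      have \<xi>M: "\<xi> \<in> M" "j \<xi> = \<xi>"
        using M_trans[OF \<xi> \<nu>M] fixed[OF Ord_trans[OF Ord_\<mu> \<nu> \<xi>]] by auto
      obtain A where A: "A \<in> elts D" "\<forall>\<alpha>\<in>elts A. \<alpha> \<in> elts \<nu> \<or> pair_in \<xi> \<alpha> F"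
        using hyp \<xi> by blast
      have AM: "A \<in> M" using M_trans[OF A(1) D_M] .
      define r where "r = Forall 4 (Imp (Mem 4 0) (Disj (Mem 4 1) (pair_fm 2 4 3)))"
      have r: "sat K r (params [a, n, x, f]) \<longleftrightarrow> (\<forall>\<alpha>\<in>elts a. \<alpha> \<in> elts n \<or> pair_in x \<alpha> f)"
        if "Transitive K" "a \<in> K" "n \<in> K" "x \<in> K" "f \<in> K" for K :: "'v set" and a n x f
        using that by (simp add: r_def) (auto simp: Transitive_def)
      have "sat M r (params [A, \<nu>, \<xi>, F])" using r[OF trM AM \<nu>M \<xi>M(1) F] A(2) by blast
      then have "sat N r (params [j A, j \<nu>, j \<xi>, j F])"
        using transfer[of A "[\<nu>, \<xi>, F]" r] AM \<nu>M \<xi>M(1) F by simp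
      then have "\<forall>\<alpha>\<in>elts (j A). \<alpha> \<in> elts (j \<nu>) \<or> pair_in \<xi> \<alpha> (j F)"
        using r[OF trN j_in[OF AM] j_in[OF \<nu>M] j_in[OF \<xi>M(1)] j_in[OF F]] \<xi>M(2) by simp
      moreover have "\<mu> \<in> elts (j A)" using A(1) elts_D by simp
      moreover have "\<mu> \<notin> elts (j \<nu>)" using \<nu> fixed mem_asym by auto
      ultimately show ?thesis by blast
    qed
    moreover have "j \<nu> = \<nu>" using fixed \<nu> .
    ultimately have "\<mu> \<in> elts (j B)"
      using B(3) q[OF trN \<kappa>_N jN N_trans[OF \<mu>_\<kappa> \<kappa>_N]] \<mu>_\<kappa> j_\<mu> by simp
    then have "B \<in> elts D" using B(1,2) elts_D by auto
    moreover have "\<forall>\<alpha>\<in>elts B. \<forall>\<xi>\<in>elts \<nu>. pair_in \<xi> \<alpha> F"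
      using B(2) q[OF trM \<mu>_M \<nu>M F] M_trans \<mu>_M by auto
    ultimately show ?thesis by blast
  qed
  then have "sat M p (params [D, \<mu>])" unfolding p[OF trM D_M \<mu>_M] by blast
  then have "sat N p (params [j D, \<kappa>])" using transfer[of D "[\<mu>]" p] D_M \<mu>_M j_\<mu> by simp
  then show ?thesis
    unfolding p[OF trN jD_N \<kappa>_N] using assms by blast
qed

text \<open>Replacing \<open>A \<xi>\<close> by the part of it that is not below \<open>\<nu>\<close> makes the coding by unordered pairs
  unambiguous, since then \<open>\<xi> < \<nu>\<close> and \<open>\<alpha> \<ge> \<nu>\<close> identify the two components.\<close>

lemma ordinal_complete:
  assumes \<nu>: "\<nu> \<in> elts \<kappa>"
    and A: "\<And>\<xi>. \<xi> \<in> elts \<nu> \<Longrightarrow> A \<xi> \<in> elts (j D)" "\<And>\<xi>. \<xi> \<in> elts \<nu> \<Longrightarrow> elts (A \<xi>) \<subseteq> elts \<kappa>"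
    and I: "elts I = {\<alpha> \<in> elts \<kappa>. \<forall>\<xi>\<in>elts \<nu>. \<alpha> \<in> elts (A \<xi>)}"
  shows "I \<in> elts (j D)"
proof (cases "elts \<nu> = {}")
  case True
  then have "I = \<kappa>" using I by (intro extensionality) auto
  then show ?thesis using \<kappa>_in by simp
next
  case False
  define X where "X = {c. \<exists>\<xi>\<in>elts \<nu>. \<exists>\<alpha>\<in>elts (A \<xi>). \<alpha> \<notin> elts \<nu> \<and> elts c = {\<xi>, \<alpha>}}"
  have \<nu>\<kappa>: "elts \<nu> \<subseteq> elts \<kappa>" using Ord_trans[OF Ord_\<kappa> \<nu>] by blast
  have X: "X \<subseteq> {v. elts v \<subseteq> elts \<kappa>}" using \<nu>\<kappa> A(2) unfolding X_def by fastforce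
  then have F: "elts (set_of X) = X" by (rule elts_set_of[OF small_subset[OF small_powerset]])
  then have FN: "set_of X \<in> N" using X N_PP by simp
  have pair: "pair_in \<xi> \<alpha> (set_of X) \<longleftrightarrow> \<alpha> \<in> elts (A \<xi>)"
    if "\<xi> \<in> elts \<nu>" "\<alpha> \<notin> elts \<nu>" for \<xi> \<alpha>
  proof
    assume "pair_in \<xi> \<alpha> (set_of X)"
    then obtain \<xi>' \<alpha>' where "\<xi>' \<in> elts \<nu>" "\<alpha>' \<in> elts (A \<xi>')" "\<alpha>' \<notin> elts \<nu>" "{\<xi>, \<alpha>} = {\<xi>', \<alpha>'}"
      unfolding pair_in_def F unfolding X_def by auto
    then show "\<alpha> \<in> elts (A \<xi>)" using that by (auto simp: doubleton_eq_iff)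
  next
    assume \<alpha>: "\<alpha> \<in> elts (A \<xi>)"
    have "elts (set_of {\<xi>, \<alpha>}) = {\<xi>, \<alpha>}" by (simp add: small_pair)
    then show "pair_in \<xi> \<alpha> (set_of X)"
      unfolding pair_in_def F unfolding X_def using that \<alpha> by blast
  qed
  have not_in: "\<alpha> \<notin> elts \<nu>" if \<xi>: "\<xi> \<in> elts \<nu>" and pr: "pair_in \<xi> \<alpha> (set_of X)" for \<xi> \<alpha>
  proof -
    obtain \<xi>' \<alpha>' where "\<xi>' \<in> elts \<nu>" "\<alpha>' \<notin> elts \<nu>" "{\<xi>, \<alpha>} = {\<xi>', \<alpha>'}"
      using pr unfolding pair_in_def F unfolding X_def by auto
    then show ?thesis using \<xi> by (auto simp: doubleton_eq_iff)
  qed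
  have "\<exists>B\<in>elts (j D). \<forall>\<alpha>\<in>elts B. \<alpha> \<in> elts \<nu> \<or> pair_in \<xi> \<alpha> (set_of X)"
    if "\<xi> \<in> elts \<nu>" for \<xi>
    using A(1)[OF that] pair[OF that] by blast
  from pair_complete[OF \<nu> FN this] obtain B where
    B: "B \<in> elts (j D)" "\<forall>\<alpha>\<in>elts B. \<forall>\<xi>\<in>elts \<nu>. pair_in \<xi> \<alpha> (set_of X)" by blast
  have "\<alpha> \<in> elts (A \<xi>)" if "\<alpha> \<in> elts B" "\<xi> \<in> elts \<nu>" for \<alpha> \<xi>
    using B(2) that pair not_in by blast
  then have "elts B \<subseteq> elts I" using A(2) False unfolding I by blast
  then show ?thesis using upward[OF B(1)] I by blast
qed

text \<open>If \<open>\<mu>\<close> were finite, it would be empty or have a largest element \<open>\<xi>\<close>, which \<open>j\<close> fixes. In both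
  cases \<open>\<mu>\<close> is definable from parameters that are fixed, so \<open>j \<mu>\<close> would be \<open>\<mu>\<close>.\<close>

lemma infinite_\<mu>: "infinite (elts \<mu>)"
proof
  assume fin: "finite (elts \<mu>)"
  have \<mu>N: "\<mu> \<in> N" using N_trans[OF \<mu>_\<kappa> \<kappa>_N] .
  show False
  proof (cases "elts \<mu> = {}")
    case True
    then show False
      using transfer[of \<mu> "[]" "Forall 4 (Neg (Mem 4 0))"] \<mu>_M \<mu>_\<kappa> \<mu>N j_\<mu> by auto
  next
    case False
    define R where "R = {(x, y). x \<in> elts y} \<inter> elts \<mu> \<times> elts \<mu>"
    \<comment> \<open>A finite well-founded relation is also well-founded upwards, which yields a largest element.\<close>
    have "finite R" using fin by (simp add: R_def)
    moreover have "acyclic R"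
      by (rule wf_acyclic, rule wf_subset[OF foundation]) (auto simp: R_def)
    ultimately have "wf (R\<inverse>)" by (rule finite_acyclic_wf_converse)
    moreover obtain x where "x \<in> elts \<mu>" using False by blast
    ultimately obtain \<xi> where \<xi>: "\<xi> \<in> elts \<mu>" "\<And>y. (y, \<xi>) \<in> R\<inverse> \<Longrightarrow> y \<notin> elts \<mu>"
      by (metis wfE_min)
    have \<xi>M: "\<xi> \<in> M" using M_trans[OF \<xi>(1) \<mu>_M] .
    define p where "p = Forall 4 (Imp (Mem 4 0) (Disj (Mem 4 1) (Eq 4 1)))"
    have p: "sat K p (params [l, x]) \<longleftrightarrow> (\<forall>y\<in>K. y \<in> elts l \<longrightarrow> y \<in> elts x \<or> y = x)"
      for K :: "'v set" and l x by (simp add: p_def)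
    have "y \<in> elts \<xi> \<or> y = \<xi>" if "y \<in> elts \<mu>" for y
      using \<xi>(2)[of y] Ord_linear[of y \<xi>] Ord_in_Ord[OF Ord_\<mu>] \<xi>(1) that by (auto simp: R_def)
    then have "sat M p (params [\<mu>, \<xi>])" unfolding p by blast
    then have "sat N p (params [\<kappa>, \<xi>])"
      using transfer[of \<mu> "[\<xi>]" p] \<mu>_M \<xi>M j_\<mu> fixed[OF \<xi>(1)] by simp
    then have "\<mu> \<in> elts \<xi> \<or> \<mu> = \<xi>" unfolding p using \<mu>N \<mu>_\<kappa> by blast
    then show False using \<xi>(1) mem_asym mem_irrefl by blast
  qed
qed

lemma uncountable_\<kappa>: "uncountable (elts \<kappa>)"
proof
  assume c: "countable (elts \<kappa>)"
  then have "elts \<kappa> \<lesssim> (UNIV :: nat set)" unfolding lepoll_def by (blast elim: countableE)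
  then have "elts \<kappa> \<lesssim> elts \<mu>"
    using infinite_\<mu> lepoll_trans infinite_le_lepoll by blast
  then show False
    using Card_mem_lesspoll[OF Card_\<kappa> \<mu>_\<kappa>] lesspoll_trans2 lesspoll_not_refl by blast
qed

lemma measurable: "measurable_card \<kappa>"
proof -
  define U where "U = {X. X \<subseteq> elts \<kappa> \<and> set_of X \<in> elts (j D)}"
  have sm: "elts (set_of X) = X" if "X \<subseteq> elts \<kappa>" for X
    by (rule elts_set_of[OF small_subset[OF small_elts that]])
  have inf: "infinite (elts \<kappa>)" using uncountable_\<kappa> uncountable_infinite by blast
  have compl: "complete_for (elts \<kappa>) U"
    unfolding complete_for_def
  proof (intro allI impI, elim conjE)
    fix \<A> assume \<A>: "\<A> \<subseteq> U" "\<A> \<noteq> {}" "\<A> \<prec> elts \<kappa>"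
    have el: "elts (set_of X) = X" if "X \<in> \<A>" for X
      using that \<A>(1) sm by (auto simp: U_def)
    have "set_of ` \<A> \<subseteq> {v. elts v \<subseteq> elts \<kappa>}" using \<A>(1) el by (auto simp: U_def)
    then have "small (set_of ` \<A>)" using small_subset[OF small_powerset] by blast
    \<comment> \<open>An ordinal of the size of the family is smaller than the cardinal \<open>\<kappa>\<close> and can index it.\<close>
    then obtain \<beta> :: 'v where \<beta>: "Ord \<beta>" "elts \<beta> \<approx> set_of ` \<A>" by (rule ex_Ord_eqpoll)
    have "set_of ` \<A> \<approx> \<A>"
      by (intro inj_on_image_eqpoll_self inj_on_inverseI[where g = elts]) (rule el)
    then have "elts \<beta> \<prec> elts \<kappa>" using \<beta>(2) \<A>(3) eqpoll_trans eq_lesspoll_trans by blast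
    then have "\<not> elts \<kappa> \<subseteq> elts \<beta>"
      using subset_imp_lepoll lesspoll_trans2 lesspoll_not_refl by blast
    then have \<beta>\<kappa>: "\<beta> \<in> elts \<kappa>" using Ord_not_mem_iff[OF \<beta>(1) Ord_\<kappa>] by blast
    obtain f where "bij_betw f (elts \<beta>) (set_of ` \<A>)" using \<beta>(2) by (auto simp: eqpoll_def)
    then have f: "f ` elts \<beta> = set_of ` \<A>" by (simp add: bij_betw_def)
    have "\<Inter>\<A> \<subseteq> elts \<kappa>" using \<A>(1,2) by (auto simp: U_def)
    then have I: "elts (set_of (\<Inter>\<A>)) = \<Inter>\<A>" by (rule sm)
    have "\<Inter>\<A> = (\<Inter>\<xi>\<in>elts \<beta>. elts (f \<xi>))"
    proof -
      have "\<Inter>\<A> = (\<Inter>v\<in>set_of ` \<A>. elts v)" using el by simp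
      then show ?thesis unfolding f[symmetric] by simp
    qed
    also have "\<dots> = {\<alpha> \<in> elts \<kappa>. \<forall>\<xi>\<in>elts \<beta>. \<alpha> \<in> elts (f \<xi>)}"
      using \<open>\<Inter>\<A> \<subseteq> elts \<kappa>\<close> unfolding calculation by auto
    finally have "elts (set_of (\<Inter>\<A>)) = {\<alpha> \<in> elts \<kappa>. \<forall>\<xi>\<in>elts \<beta>. \<alpha> \<in> elts (f \<xi>)}"
      using I by simp
    moreover have "f \<xi> \<in> elts (j D)" "elts (f \<xi>) \<subseteq> elts \<kappa>" if \<xi>: "\<xi> \<in> elts \<beta>" for \<xi>
    proof -
      obtain X where "X \<in> \<A>" "f \<xi> = set_of X" using f \<xi> by blast
      then show "f \<xi> \<in> elts (j D)" "elts (f \<xi>) \<subseteq> elts \<kappa>" using \<A>(1) el by (auto simp: U_def)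
    qed
    ultimately have "set_of (\<Inter>\<A>) \<in> elts (j D)" using ordinal_complete[OF \<beta>\<kappa>, of f] by blast
    then show "\<Inter>\<A> \<in> U" using \<open>\<Inter>\<A> \<subseteq> elts \<kappa>\<close> by (simp add: U_def)
  qed
  have "ultrafilter_on (elts \<kappa>) U"
    unfolding ultrafilter_on_def
  proof (intro conjI allI ballI impI)
    show "U \<subseteq> Pow (elts \<kappa>)" by (auto simp: U_def)
    show "elts \<kappa> \<in> U" using \<kappa>_in by (simp add: U_def)
    show "{} \<notin> U" using two_points[of "set_of {}" \<mu>] \<mu>_\<kappa> sm[of "{}"] by (auto simp: U_def)
    show "B \<in> U" if "A \<in> U" "A \<subseteq> B \<and> B \<subseteq> elts \<kappa>" for A B
      using that upward[of "set_of A" "set_of B"] sm by (auto simp: U_def)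
    show "A \<inter> B \<in> U" if "A \<in> U" "B \<in> U" for A B
    proof -
      have "{A, B} \<prec> elts \<kappa>" using inf by (simp add: finite_lesspoll_infinite)
      then show ?thesis
        using compl[unfolded complete_for_def, rule_format, of "{A, B}"] that by simp
    qed
    show "A \<in> U \<or> elts \<kappa> - A \<in> U" if "A \<subseteq> elts \<kappa>" for A
      using that complement[of "set_of A" "set_of (elts \<kappa> - A)"] sm by (auto simp: U_def)
  qed
  moreover have "nonprincipal_on (elts \<kappa>) U"
    unfolding nonprincipal_on_def
    using two_points sm by (fastforce simp: U_def)
  ultimately show ?thesis
    using compl Card_\<kappa> uncountable_\<kappa> unfolding measurable_card_def by blast
qed

end

lemma measurable_if_small_embedding:
  assumes se: "small_embedding \<kappa> \<theta> M j"
    and D: "D \<in> elts M"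
      "elts D = {A \<in> elts M. elts A \<subseteq> elts (crit (elts M) j) \<and> crit (elts M) j \<in> elts (j A)}"
    and big: "{v. elts v \<subseteq> elts \<kappa>} \<prec> elts \<theta>"
  shows "measurable_card \<kappa>"
proof -
  have "full_embedding (elts M) (Hset \<theta>) j"
    using se Hset_full_embedding by (auto simp: small_embedding_def)
  moreover have "derived_measure_axioms (elts M) (Hset \<theta>) j \<kappa> (crit (elts M) j) D"
  proof
    show "x \<in> Hset \<theta>" if "elts x \<subseteq> {v. elts v \<subseteq> elts \<kappa>}" for x
    proof (rule HsetI[OF that _ big])
      have "Ord \<kappa>" using se Card_Ord by (auto simp: small_embedding_def)
      then show "Transitive {v. elts v \<subseteq> elts \<kappa>}"
        using Ord_trans by (fastforce simp: Transitive_def)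
    qed
    show "elts (crit (elts M) j) \<subseteq> elts \<beta>" if "moves (elts M) j \<beta>" for \<beta>
      using least_moved(2)[OF _ that] se by (simp add: small_embedding_def)
  qed (use se D least_moved(1) in \<open>auto simp: small_embedding_def\<close>)
  ultimately interpret derived_measure "elts M" "Hset \<theta>" j \<kappa> "crit (elts M) j" D
    by (rule derived_measure.intro)
  show ?thesis by (rule measurable)
qed


section \<open>Normal measures\<close>

locale measure_on =
  fixes \<kappa> :: "'v::zfc" and U
  assumes Card_\<kappa>: "Card \<kappa>" and uncountable_\<kappa>: "uncountable (elts \<kappa>)"
    and ultra: "ultrafilter_on (elts \<kappa>) U" and complete: "complete_for (elts \<kappa>) U"
begin

lemma Ord_\<kappa>: "Ord \<kappa>"
  using Card_\<kappa> Card_Ord by blast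

lemma infinite_\<kappa>: "infinite (elts \<kappa>)"
  using uncountable_\<kappa> uncountable_infinite by blast

lemma in_U_subset: "A \<in> U \<Longrightarrow> A \<subseteq> elts \<kappa>"
  using ultra by (auto simp: ultrafilter_on_def)

lemma \<kappa>_in_U: "elts \<kappa> \<in> U"
  using ultra by (auto simp: ultrafilter_on_def)

lemma empty_notin_U: "{} \<notin> U"
  using ultra by (auto simp: ultrafilter_on_def)

lemma in_U_nonempty: "A \<in> U \<Longrightarrow> \<exists>x. x \<in> A"
  using empty_notin_U by (cases "A = {}") auto

lemma superset_in_U: "A \<in> U \<Longrightarrow> A \<subseteq> B \<Longrightarrow> B \<subseteq> elts \<kappa> \<Longrightarrow> B \<in> U"
  using ultra unfolding ultrafilter_on_def by blast

lemma Int_in_U: "A \<in> U \<Longrightarrow> B \<in> U \<Longrightarrow> A \<inter> B \<in> U"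
  using ultra by (auto simp: ultrafilter_on_def)

lemma complement_in_U: "A \<subseteq> elts \<kappa> \<Longrightarrow> A \<notin> U \<Longrightarrow> elts \<kappa> - A \<in> U"
  using ultra unfolding ultrafilter_on_def by blast

lemma INT_in_U:
  assumes "I \<prec> elts \<kappa>" "\<And>i. i \<in> I \<Longrightarrow> A i \<in> U"
  shows "{\<xi> \<in> elts \<kappa>. \<forall>i\<in>I. \<xi> \<in> A i} \<in> U"
proof (cases "I = {}")
  case True
  then show ?thesis using \<kappa>_in_U by simp
next
  case False
  have "A ` I \<prec> elts \<kappa>" using assms(1) lesspoll_trans1[OF image_lepoll] by blast
  then have "\<Inter>(A ` I) \<in> U"
    using complete[unfolded complete_for_def, rule_format, of "A ` I"] assms(2) False by auto
  then show ?thesis by (rule superset_in_U) (use False assms(2) in_U_subset in blast)+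
qed

text \<open>Otherwise all complements of the \<open>A i\<close> are in \<open>U\<close>, and so is their intersection, which misses the
  union.\<close>

lemma UN_in_U:
  assumes "I \<prec> elts \<kappa>" "\<And>i. i \<in> I \<Longrightarrow> A i \<subseteq> elts \<kappa>"
    and "{\<xi> \<in> elts \<kappa>. \<exists>i\<in>I. \<xi> \<in> A i} \<in> U"
  obtains i where "i \<in> I" "A i \<in> U"
proof (rule ccontr)
  assume "\<not> thesis"
  then have "{\<xi> \<in> elts \<kappa>. \<forall>i\<in>I. \<xi> \<in> elts \<kappa> - A i} \<in> U"
    using that assms(2) by (intro INT_in_U[OF assms(1)] complement_in_U) blast+
  from Int_in_U[OF this assms(3)] have "{} \<in> U"
    by (rule back_subst[of "\<lambda>X. X \<in> U"]) auto
  then show False using empty_notin_U by simp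
qed

lemma nat_lesspoll_\<kappa>: "(UNIV :: nat set) \<prec> elts \<kappa>"
  using infinite_\<kappa> uncountable_\<kappa> countable_eqpoll[of "UNIV :: nat set" "elts \<kappa>"]
  by (auto simp: lesspoll_def infinite_le_lepoll[symmetric] dest: eqpoll_sym)

lemma insert_lesspoll_\<kappa>:
  assumes "A \<prec> elts \<kappa>"
  shows "insert a A \<prec> elts \<kappa>"
proof (cases "finite A")
  case True
  then show ?thesis using infinite_\<kappa> by (simp add: finite_lesspoll_infinite)
next
  case False
  then show ?thesis by (rule eq_lesspoll_trans[OF infinite_insert_eqpoll assms])
qed

lemma succ_lesspoll_\<kappa>: "\<beta> \<in> elts \<kappa> \<Longrightarrow> insert \<beta> (elts \<beta>) \<prec> elts \<kappa>"
  by (intro insert_lesspoll_\<kappa> Card_mem_lesspoll[OF Card_\<kappa>])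

lemma below_iff:
  "\<xi> \<in> elts \<kappa> \<Longrightarrow> \<beta> \<in> elts \<kappa> \<Longrightarrow> \<beta> \<notin> elts \<xi> \<longleftrightarrow> \<xi> \<in> insert \<beta> (elts \<beta>)"
  using Ord_linear[of \<xi> \<beta>] Ord_in_Ord[OF Ord_\<kappa>] mem_asym mem_irrefl by blast

end

text \<open>In the ultrapower by \<open>U\<close>, these functions represent the ordinals from \<open>\<kappa>\<close> up to the image of
  \<open>\<kappa>\<close>; a minimal one represents \<open>\<kappa>\<close> itself.\<close>

definition unbounded_mod :: "'v::zfc \<Rightarrow> 'v set set \<Rightarrow> ('v \<Rightarrow> 'v) \<Rightarrow> bool" where
  "unbounded_mod \<kappa> U f \<longleftrightarrow> f ` elts \<kappa> \<subseteq> elts \<kappa> \<and>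
     (\<forall>\<beta>\<in>elts \<kappa>. {\<xi> \<in> elts \<kappa>. \<beta> \<in> elts (f \<xi>)} \<in> U)"

locale normal_measure = measure_on +
  assumes unbounded: "\<beta> \<in> elts \<kappa> \<Longrightarrow> {\<alpha> \<in> elts \<kappa>. \<beta> \<in> elts \<alpha>} \<in> U"
    and diagonal: "(\<And>\<beta>. \<beta> \<in> elts \<kappa> \<Longrightarrow> E \<beta> \<in> U) \<Longrightarrow> {\<alpha> \<in> elts \<kappa>. \<forall>\<beta>\<in>elts \<alpha>. \<alpha> \<in> E \<beta>} \<in> U"

context measure_on
begin

text \<open>By countable completeness, an infinite descending sequence of functions descends at one and the
  same argument \<open>\<xi>\<close>, against Foundation.\<close>

lemma wf_less_mod: "wf {(f :: 'v \<Rightarrow> 'v, g). {\<xi> \<in> elts \<kappa>. f \<xi> \<in> elts (g \<xi>)} \<in> U}"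
  unfolding wf_iff_no_infinite_down_chain
proof
  assume "\<exists>f. \<forall>i. (f (Suc i), f i) \<in> {(f :: 'v \<Rightarrow> 'v, g). {\<xi> \<in> elts \<kappa>. f \<xi> \<in> elts (g \<xi>)} \<in> U}"
  then obtain f :: "nat \<Rightarrow> 'v \<Rightarrow> 'v" where f: "\<And>i. {\<xi> \<in> elts \<kappa>. f (Suc i) \<xi> \<in> elts (f i \<xi>)} \<in> U" by blast
  have "{\<xi> \<in> elts \<kappa>. \<forall>i\<in>UNIV. \<xi> \<in> {\<xi> \<in> elts \<kappa>. f (Suc i) \<xi> \<in> elts (f i \<xi>)}} \<in> U"
    by (intro INT_in_U[OF nat_lesspoll_\<kappa>] f)
  from in_U_nonempty[OF this] obtain \<xi> where "\<And>i. f (Suc i) \<xi> \<in> elts (f i \<xi>)" by blast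
  then have "\<exists>h. \<forall>i. (h (Suc i), h i) \<in> {(x, y). x \<in> elts (y :: 'v)}"
    by (intro exI[of _ "\<lambda>i. f i \<xi>"]) simp
  then show False
    using foundation unfolding wf_iff_no_infinite_down_chain by blast
qed

text \<open>The set of \<open>\<xi>\<close> that are not above \<open>\<beta>\<close> is a union of fewer than \<open>\<kappa>\<close> singletons.\<close>

lemma identity_unbounded:
  assumes "nonprincipal_on (elts \<kappa>) U"
  shows "unbounded_mod \<kappa> U (\<lambda>\<xi>. \<xi>)"
  unfolding unbounded_mod_def
proof (intro conjI ballI)
  fix \<beta> assume \<beta>: "\<beta> \<in> elts \<kappa>"
  have "insert \<beta> (elts \<beta>) \<subseteq> elts \<kappa>" using Ord_trans[OF Ord_\<kappa> \<beta>] \<beta> by blast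
  then have "{\<xi> \<in> elts \<kappa>. \<forall>\<gamma>\<in>insert \<beta> (elts \<beta>). \<xi> \<in> elts \<kappa> - {\<gamma>}} \<in> U"
    using assms unfolding nonprincipal_on_def
    by (intro INT_in_U[OF succ_lesspoll_\<kappa>[OF \<beta>]] complement_in_U) blast+
  then show "{\<xi> \<in> elts \<kappa>. \<beta> \<in> elts \<xi>} \<in> U"
    by (rule superset_in_U) (use below_iff \<beta> in blast)+
qed simp

text \<open>Let \<open>f\<close> be minimal among the functions that are unbounded modulo \<open>U\<close>, and let \<open>W\<close> be the image of
  \<open>U\<close> under \<open>f\<close>. Suppose the diagonal intersection of \<open>E \<beta> \<in> W\<close> is not in \<open>W\<close>. Then for
  \<open>U\<close>-almost all \<open>\<xi>\<close> some \<open>\<beta> = g \<xi> < f \<xi>\<close> satisfies \<open>f \<xi> \<notin> E \<beta>\<close>. By minimality \<open>g\<close> is bounded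
  modulo \<open>U\<close>, so by completeness it is almost everywhere equal to some \<open>\<gamma>\<close>. This contradicts
  \<open>E \<gamma> \<in> W\<close>.\<close>

lemma ex_normal_measure:
  assumes "nonprincipal_on (elts \<kappa>) U"
  obtains W where "normal_measure \<kappa> W"
proof -
  have "(\<lambda>\<xi>. \<xi>) \<in> {f. unbounded_mod \<kappa> U f}" using identity_unbounded[OF assms] by simp
  from wfE_min[OF wf_less_mod this] obtain f where
    f: "unbounded_mod \<kappa> U f"
    and minimal: "\<And>g. {\<xi> \<in> elts \<kappa>. g \<xi> \<in> elts (f \<xi>)} \<in> U \<Longrightarrow> \<not> unbounded_mod \<kappa> U g"
    by auto
  have f\<kappa>: "f \<xi> \<in> elts \<kappa>" if "\<xi> \<in> elts \<kappa>" for \<xi>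
    using f that by (auto simp: unbounded_mod_def)
  define P where "P A = {\<xi> \<in> elts \<kappa>. f \<xi> \<in> A}" for A
  define W where "W = {A. A \<subseteq> elts \<kappa> \<and> P A \<in> U}"
  have P\<kappa>: "P A \<subseteq> elts \<kappa>" for A by (auto simp: P_def)
  have "complete_for (elts \<kappa>) W"
    unfolding complete_for_def
  proof (intro allI impI, elim conjE)
    fix \<A> assume \<A>: "\<A> \<subseteq> W" "\<A> \<noteq> {}" "\<A> \<prec> elts \<kappa>"
    have "{\<xi> \<in> elts \<kappa>. \<forall>A\<in>\<A>. \<xi> \<in> P A} \<in> U"
      using \<A> by (intro INT_in_U) (auto simp: W_def)
    also have "{\<xi> \<in> elts \<kappa>. \<forall>A\<in>\<A>. \<xi> \<in> P A} = P (\<Inter>\<A>)"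
      by (auto simp: P_def)
    finally show "\<Inter>\<A> \<in> W" using \<A>(1,2) by (auto simp: W_def)
  qed
  moreover have "ultrafilter_on (elts \<kappa>) W"
    unfolding ultrafilter_on_def
  proof (intro conjI allI ballI impI)
    show "W \<subseteq> Pow (elts \<kappa>)" by (auto simp: W_def)
    have "P (elts \<kappa>) = elts \<kappa>" using f\<kappa> by (auto simp: P_def)
    then show "elts \<kappa> \<in> W" using \<kappa>_in_U by (simp add: W_def)
    show "{} \<notin> W" using empty_notin_U by (simp add: W_def P_def)
    show "B \<in> W" if "A \<in> W" "A \<subseteq> B \<and> B \<subseteq> elts \<kappa>" for A B
      using that superset_in_U[of "P A" "P B"] P\<kappa> by (auto simp: W_def P_def)
    show "A \<inter> B \<in> W" if "A \<in> W" "B \<in> W" for A B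
    proof -
      have "P (A \<inter> B) = P A \<inter> P B" by (auto simp: P_def)
      then show ?thesis using that Int_in_U by (auto simp: W_def)
    qed
    show "A \<in> W \<or> elts \<kappa> - A \<in> W" if "A \<subseteq> elts \<kappa>" for A
    proof -
      have "P (elts \<kappa> - A) = elts \<kappa> - P A" using f\<kappa> by (auto simp: P_def)
      then show ?thesis using that complement_in_U[OF P\<kappa>, of A] by (auto simp: W_def)
    qed
  qed
  moreover have "{\<alpha> \<in> elts \<kappa>. \<beta> \<in> elts \<alpha>} \<in> W" if "\<beta> \<in> elts \<kappa>" for \<beta>
  proof -
    have "P {\<alpha> \<in> elts \<kappa>. \<beta> \<in> elts \<alpha>} = {\<xi> \<in> elts \<kappa>. \<beta> \<in> elts (f \<xi>)}"
      using f\<kappa> by (auto simp: P_def)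
    then show ?thesis using f that by (simp add: W_def unbounded_mod_def)
  qed
  moreover have "{\<alpha> \<in> elts \<kappa>. \<forall>\<beta>\<in>elts \<alpha>. \<alpha> \<in> E \<beta>} \<in> W" (is "?\<Delta> \<in> W")
    if E: "\<And>\<beta>. \<beta> \<in> elts \<kappa> \<Longrightarrow> E \<beta> \<in> W" for E
  proof (rule ccontr)
    assume "?\<Delta> \<notin> W"
    then have "P ?\<Delta> \<notin> U" by (auto simp: W_def)
    then have "elts \<kappa> - P ?\<Delta> \<in> U" using complement_in_U[OF P\<kappa>] by blast
    also have "elts \<kappa> - P ?\<Delta> = {\<xi> \<in> elts \<kappa>. \<exists>\<beta>. \<beta> \<in> elts (f \<xi>) \<and> f \<xi> \<notin> E \<beta>}"
      using f\<kappa> by (auto simp: P_def)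
    finally have T: "{\<xi> \<in> elts \<kappa>. \<exists>\<beta>. \<beta> \<in> elts (f \<xi>) \<and> f \<xi> \<notin> E \<beta>} \<in> U" (is "?T \<in> U") .
    define g where
      "g \<xi> = (if \<xi> \<in> ?T then SOME \<beta>. \<beta> \<in> elts (f \<xi>) \<and> f \<xi> \<notin> E \<beta> else f \<xi>)" for \<xi>
    have gT: "g \<xi> \<in> elts (f \<xi>)" "f \<xi> \<notin> E (g \<xi>)" if "\<xi> \<in> ?T" for \<xi>
    proof -
      have "\<exists>\<beta>. \<beta> \<in> elts (f \<xi>) \<and> f \<xi> \<notin> E \<beta>" using that by simp
      from someI_ex[OF this] show "g \<xi> \<in> elts (f \<xi>)" "f \<xi> \<notin> E (g \<xi>)"
        unfolding g_def using that by simp_all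
    qed
    have "{\<xi> \<in> elts \<kappa>. g \<xi> \<in> elts (f \<xi>)} \<in> U"
      using gT(1) by (intro superset_in_U[OF T]) blast+
    then have "\<not> unbounded_mod \<kappa> U g" by (rule minimal)
    moreover have "g \<xi> \<in> elts \<kappa>" if "\<xi> \<in> elts \<kappa>" for \<xi>
    proof (cases "\<xi> \<in> ?T")
      case True
      show ?thesis using Ord_trans[OF Ord_\<kappa> f\<kappa>[OF that] gT(1)[OF True]] .
    next
      case False
      then have "g \<xi> = f \<xi>" unfolding g_def by (rule if_not_P)
      then show ?thesis using f\<kappa> that by simp
    qed
    ultimately obtain \<beta> where \<beta>: "\<beta> \<in> elts \<kappa>" "{\<xi> \<in> elts \<kappa>. \<beta> \<in> elts (g \<xi>)} \<notin> U"
      unfolding unbounded_mod_def by blast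
    have "elts \<kappa> - {\<xi> \<in> elts \<kappa>. \<beta> \<in> elts (g \<xi>)} \<in> U"
      using \<beta>(2) by (intro complement_in_U) auto
    then have "{\<xi> \<in> elts \<kappa>. \<exists>\<gamma>\<in>insert \<beta> (elts \<beta>). \<xi> \<in> {\<xi> \<in> elts \<kappa>. g \<xi> = \<gamma>}} \<in> U"
      by (rule superset_in_U) (use below_iff[OF _ \<beta>(1)] \<open>\<And>\<xi>. \<xi> \<in> elts \<kappa> \<Longrightarrow> g \<xi> \<in> elts \<kappa>\<close> in blast)+
    then obtain \<gamma> where \<gamma>: "\<gamma> \<in> insert \<beta> (elts \<beta>)" "{\<xi> \<in> elts \<kappa>. g \<xi> = \<gamma>} \<in> U"
      by (rule UN_in_U[OF succ_lesspoll_\<kappa>[OF \<beta>(1)], rotated]) auto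
    have "\<gamma> \<in> elts \<kappa>" using \<gamma>(1) \<beta>(1) Ord_trans[OF Ord_\<kappa> \<beta>(1)] by blast
    then have "P (E \<gamma>) \<in> U" using E by (simp add: W_def)
    then have "P (E \<gamma>) \<inter> ({\<xi> \<in> elts \<kappa>. g \<xi> = \<gamma>} \<inter> ?T) \<in> U"
      using Int_in_U \<gamma>(2) T by blast
    moreover have "P (E \<gamma>) \<inter> ({\<xi> \<in> elts \<kappa>. g \<xi> = \<gamma>} \<inter> ?T) = {}"
      using gT(2) unfolding P_def by blast
    ultimately show False using empty_notin_U by simp
  qed
  ultimately have "normal_measure \<kappa> W"
    using Card_\<kappa> uncountable_\<kappa> by unfold_locales blast+
  then show thesis by (rule that)
qed

end


section \<open>Skolem hulls\<close>

instance fm :: countable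
  by countable_datatype

lemma infinite_times_lepoll:
  assumes "infinite T" "A \<lesssim> T" "B \<lesssim> T"
  shows "A \<times> B \<lesssim> T"
proof -
  have "T \<times> T \<lesssim> T"
    using card_of_Times_same_infinite[OF assms(1)]
    by (simp add: eqpoll_imp_lepoll eqpoll_iff_card_of_ordIso)
  then show ?thesis using times_lepoll_mono[OF assms(2,3)] lepoll_trans by blast
qed

lemma infinite_UN_nat_lepoll:
  assumes "infinite T" "\<And>n::nat. A n \<lesssim> T"
  shows "(\<Union>n. A n) \<lesssim> T"
proof -
  obtain f where f: "\<And>n. inj_on (f n) (A n)" "\<And>n. f n ` A n \<subseteq> T"
    using assms(2) unfolding lepoll_def by metis
  define k where "k x = (SOME n. x \<in> A n)" for x
  have k: "x \<in> A (k x)" if "x \<in> A n" for x n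
    unfolding k_def using that by (rule someI)
  have "inj_on (\<lambda>x. (k x, f (k x) x)) (\<Union>n. A n)"
    using k f(1) by (auto simp: inj_on_def) metis
  moreover have "(\<lambda>x. (k x, f (k x) x)) ` (\<Union>n. A n) \<subseteq> UNIV \<times> T"
    using k f(2) by fast
  ultimately have "(\<Union>n. A n) \<lesssim> (UNIV :: nat set) \<times> T" unfolding lepoll_def by blast
  also have "\<dots> \<lesssim> T"
    using assms(1) by (intro infinite_times_lepoll) (auto simp: infinite_le_lepoll)
  finally show ?thesis .
qed

lemma infinite_Un_lepoll:
  assumes "infinite T" "A \<lesssim> T" "B \<lesssim> T"
  shows "A \<union> B \<lesssim> T"
proof -
  have "(\<Union>n::nat. if n = 0 then A else B) \<lesssim> T"
    using assms by (intro infinite_UN_nat_lepoll) auto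
  moreover have "A \<union> B \<subseteq> (\<Union>n::nat. if n = 0 then A else B)"
    by (auto intro: exI[of _ 0] exI[of _ 1])
  ultimately show ?thesis using lepoll_trans subset_imp_lepoll by blast
qed

lemma infinite_lists_lepoll:
  assumes "infinite T" "A \<lesssim> T"
  shows "lists A \<lesssim> T"
proof -
  have "{l \<in> lists A. length l = n} \<lesssim> T" for n
  proof (induction n)
    case 0
    obtain t where "t \<in> T" using assms(1) by fastforce
    have "{l \<in> lists A. length l = 0} \<subseteq> (\<lambda>_. []) ` {t}" by auto
    then have "{l \<in> lists A. length l = 0} \<lesssim> {t}" by (rule subset_image_lepoll)
    also have "{t} \<lesssim> T" using \<open>t \<in> T\<close> by (intro subset_imp_lepoll) simp
    finally show ?case .
  next
    case (Suc n)
    have "{l \<in> lists A. length l = Suc n} \<subseteq> (\<lambda>(x, l). x # l) ` (A \<times> {l \<in> lists A. length l = n})"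
    proof
      fix l assume "l \<in> {l \<in> lists A. length l = Suc n}"
      then obtain x k where "l = x # k" "x \<in> A" "k \<in> lists A" "length k = n"
        by (cases l) auto
      then show "l \<in> (\<lambda>(x, l). x # l) ` (A \<times> {l \<in> lists A. length l = n})"
        by (intro image_eqI[of _ _ "(x, k)"]) auto
    qed
    then have "{l \<in> lists A. length l = Suc n} \<lesssim> A \<times> {l \<in> lists A. length l = n}"
      by (rule subset_image_lepoll)
    also have "\<dots> \<lesssim> T" using assms Suc by (intro infinite_times_lepoll)
    finally show ?case .
  qed
  then have "(\<Union>n. {l \<in> lists A. length l = n}) \<lesssim> T"
    using assms(1) by (intro infinite_UN_nat_lepoll)
  moreover have "lists A \<subseteq> (\<Union>n. {l \<in> lists A. length l = n})" by auto
  ultimately show ?thesis using lepoll_trans subset_imp_lepoll by blast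
qed

primrec bound :: "fm \<Rightarrow> nat" where
  "bound (Mem i k) = Suc (max i k)"
| "bound (Eq i k) = Suc (max i k)"
| "bound (Neg p) = bound p"
| "bound (Conj p q) = max (bound p) (bound q)"
| "bound (Ex i p) = bound p"

lemma sat_bound_cong: "(\<And>i. i < bound p \<Longrightarrow> s i = t i) \<Longrightarrow> sat M p s \<longleftrightarrow> sat M p t"
proof (induction p arbitrary: s t)
  case (Mem i k)
  show ?case using Mem.prems[of i] Mem.prems[of k] by simp
next
  case (Eq i k)
  show ?case using Eq.prems[of i] Eq.prems[of k] by simp
next
  case (Neg p)
  have "sat M p s \<longleftrightarrow> sat M p t" by (rule Neg.IH) (simp add: Neg.prems)
  then show ?case by simp
next
  case (Conj p q)
  have "sat M p s \<longleftrightarrow> sat M p t" "sat M q s \<longleftrightarrow> sat M q t"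
    by (rule Conj.IH; simp add: Conj.prems)+
  then show ?case by simp
next
  case (Ex i p)
  have "sat M p (s(i := a)) \<longleftrightarrow> sat M p (t(i := a))" for a
    by (rule Ex.IH) (simp add: Ex.prems)
  then show ?case by simp
qed

lemma params_nth: "n < length xs \<Longrightarrow> params xs n = xs ! n"
  by (induction xs n rule: params.induct) (auto split: nat.splits)

text \<open>A witness for the existential formula with bound variable \<open>i\<close> and matrix \<open>p\<close>; the value \<open>c\<close> is
  returned if there is none, which keeps the function total on \<open>H\<close> when \<open>c \<in> H\<close>. The parameters form
  a finite list, so that there are no more Skolem terms over an infinite set than elements.\<close>

definition skolem :: "'v::zfc set \<Rightarrow> 'v \<Rightarrow> nat \<Rightarrow> fm \<Rightarrow> 'v list \<Rightarrow> 'v" where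
  "skolem H c i p l =
     (if \<exists>a\<in>H. sat H p ((params l)(i := a)) then SOME a. a \<in> H \<and> sat H p ((params l)(i := a)) else c)"

lemma skolem_in: "c \<in> H \<Longrightarrow> skolem H c i p l \<in> H"
  unfolding skolem_def using someI_ex[of "\<lambda>a. a \<in> H \<and> sat H p ((params l)(i := a))"] by auto

lemma sat_skolem:
  "a \<in> H \<Longrightarrow> sat H p ((params l)(i := a)) \<Longrightarrow> sat H p ((params l)(i := skolem H c i p l))"
  unfolding skolem_def using someI_ex[of "\<lambda>a. a \<in> H \<and> sat H p ((params l)(i := a))"] by auto

text \<open>The Tarski-Vaught criterion: a formula depends on finitely many variables only, so any witness
  that is required in \<open>H\<close> can be replaced by the Skolem function of a finite list of values in \<open>Y\<close>.\<close>

lemma skolem_closed_elementary: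
  assumes "Y \<subseteq> H" and closed: "\<And>i p l. set l \<subseteq> Y \<Longrightarrow> skolem H c i p l \<in> Y"
  shows "elementary Y H (\<lambda>x. x)"
proof -
  have "sat Y p s \<longleftrightarrow> sat H p s" if "range s \<subseteq> Y" for p s
    using that
  proof (induction p arbitrary: s)
    case (Ex i p)
    have IH: "sat Y p (s(i := a)) \<longleftrightarrow> sat H p (s(i := a))" if "a \<in> Y" for a
      using Ex.prems that by (intro Ex.IH) auto
    have "\<exists>b\<in>Y. sat H p (s(i := b))" if a: "a \<in> H" "sat H p (s(i := a))" for a
    proof -
      \<comment> \<open>One value more than needed, so that the list is not empty for a formula with bound 0.\<close>
      define l where "l = map s [0..<Suc (bound p)]"
      have l: "params l n = s n" if "n < bound p" for n
        using that params_nth[of n l] by (simp add: l_def del: upt_Suc)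
      have "sat H p ((params l)(i := b)) \<longleftrightarrow> sat H p (s(i := b))" for b
        using l by (intro sat_bound_cong) simp
      then have "sat H p (s(i := skolem H c i p l))" using sat_skolem a by blast
      moreover have "skolem H c i p l \<in> Y"
        using Ex.prems by (intro closed) (auto simp: l_def)
      ultimately show ?thesis by blast
    qed
    then show ?case using IH assms(1) by auto
  qed auto
  then show ?thesis using assms(1) by (simp add: elementary_def comp_def)
qed

primrec hull_stage :: "'v::zfc set \<Rightarrow> 'v \<Rightarrow> 'v set \<Rightarrow> nat \<Rightarrow> 'v set" where
  "hull_stage H c S 0 = S"
| "hull_stage H c S (Suc n) = hull_stage H c S n \<union>
     (\<lambda>(i, p, l). skolem H c i p l) ` (UNIV \<times> UNIV \<times> lists (hull_stage H c S n))"

definition hull :: "'v::zfc set \<Rightarrow> 'v \<Rightarrow> 'v set \<Rightarrow> 'v set" where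
  "hull H c S = (\<Union>n. hull_stage H c S n)"

lemma subset_hull: "S \<subseteq> hull H c S"
  unfolding hull_def by (rule subset_trans[OF _ UN_upper[of 0]]) auto

lemma hull_subset:
  assumes "S \<subseteq> H" "c \<in> H"
  shows "hull H c S \<subseteq> H"
proof -
  have "hull_stage H c S n \<subseteq> H" for n
    by (induction n) (use assms skolem_in in auto)
  then show ?thesis by (auto simp: hull_def)
qed

lemma hull_mono:
  assumes "S \<subseteq> S'"
  shows "hull H c S \<subseteq> hull H c S'"
proof -
  have "hull_stage H c S n \<subseteq> hull_stage H c S' n" for n
  proof (induction n)
    case (Suc n)
    show ?case
      unfolding hull_stage.simps
      by (intro Un_mono image_mono Sigma_mono lists_mono Suc subset_refl)
  qed (use assms in simp)
  then show ?thesis unfolding hull_def by blast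
qed

lemma list_in_chain:
  fixes A :: "'i::linorder \<Rightarrow> 'a set"
  assumes "set l \<subseteq> (\<Union>n. A n)" "\<And>m n. m \<le> n \<Longrightarrow> A m \<subseteq> A n"
  shows "\<exists>n. set l \<subseteq> A n"
  using assms(1)
proof (induction l)
  case (Cons x l)
  then obtain m n where "x \<in> A m" "set l \<subseteq> A n" by auto
  then have "set (x # l) \<subseteq> A (max m n)"
    using assms(2)[of m "max m n"] assms(2)[of n "max m n"] by auto
  then show ?case by blast
qed simp

lemma hull_closed:
  assumes "set l \<subseteq> hull H c S"
  shows "skolem H c i p l \<in> hull H c S"
proof -
  have "hull_stage H c S m \<subseteq> hull_stage H c S n" if "m \<le> n" for m n
    using that by (induction rule: dec_induct) auto
  then obtain n where "set l \<subseteq> hull_stage H c S n"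
    using list_in_chain[of l "hull_stage H c S"] assms unfolding hull_def by blast
  then have "skolem H c i p l \<in> hull_stage H c S (Suc n)" by force
  then show ?thesis unfolding hull_def by blast
qed

lemma hull_lepoll:
  assumes "infinite T" "S \<lesssim> T"
  shows "hull H c S \<lesssim> T"
proof -
  have nat: "(UNIV :: nat set) \<lesssim> T" using assms(1) by (simp add: infinite_le_lepoll)
  have "(UNIV :: fm set) \<lesssim> (UNIV :: nat set)"
    unfolding lepoll_def using inj_to_nat by blast
  then have fm: "(UNIV :: fm set) \<lesssim> T" using nat lepoll_trans by blast
  have "hull_stage H c S n \<lesssim> T" for n
  proof (induction n)
    case (Suc n)
    have "(UNIV :: nat set) \<times> (UNIV :: fm set) \<times> lists (hull_stage H c S n) \<lesssim> T"
      using assms(1) nat fm Suc by (intro infinite_times_lepoll infinite_lists_lepoll)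
    then have "(\<lambda>(i, p, l). skolem H c i p l) ` (UNIV \<times> UNIV \<times> lists (hull_stage H c S n)) \<lesssim> T"
      using image_lepoll lepoll_trans by blast
    then show ?case using assms(1) Suc by (simp add: infinite_Un_lepoll)
  qed (use assms in simp)
  then show ?thesis unfolding hull_def using assms(1) by (intro infinite_UN_nat_lepoll)
qed

lemma (in measure_on) hull_lesspoll_\<kappa>:
  assumes "S \<prec> elts \<kappa>"
  shows "hull H c S \<prec> elts \<kappa>"
proof (cases "finite S")
  case True
  then have "S \<lesssim> (UNIV :: nat set)" by (simp add: finite_lepoll_infinite)
  then have "hull H c S \<lesssim> (UNIV :: nat set)" by (intro hull_lepoll) simp_all
  then show ?thesis using nat_lesspoll_\<kappa> by (rule lesspoll_trans1)
next
  case False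
  then have "hull H c S \<lesssim> S" by (intro hull_lepoll) simp_all
  then show ?thesis using assms by (rule lesspoll_trans1)
qed


section \<open>From measures to small embeddings\<close>

context normal_measure
begin

text \<open>Each hull \<open>Z \<beta>\<close> has fewer than \<open>\<kappa>\<close> elements, so completeness gives a set \<open>E \<beta>\<close> in the measure of
  points \<open>\<alpha>\<close> that lie above all ordinals of \<open>Z \<beta>\<close> below \<open>\<kappa>\<close> and inside all measure-one sets of
  \<open>Z \<beta>\<close>. Any nonzero \<open>\<alpha>\<close> in the diagonal intersection of the \<open>E \<beta>\<close> works, with \<open>Y\<close> the union of
  the \<open>Z \<beta>\<close> for \<open>\<beta> < \<alpha>\<close>: as \<open>\<beta> \<in> Z \<beta>\<close>, all ordinals below \<open>\<alpha>\<close> are in \<open>Y\<close>, and as the \<open>Z \<beta>\<close> form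
  a chain, their union is closed under the Skolem functions.\<close>

lemma ex_reflecting_submodel:
  assumes "\<kappa> \<in> H" "w \<in> H" "elts \<kappa> \<subseteq> H"
  obtains \<alpha> Y where "\<alpha> \<in> elts \<kappa>" "Y \<subseteq> H" "\<kappa> \<in> Y" "w \<in> Y" "Y \<inter> elts \<kappa> = elts \<alpha>"
    "Y \<prec> elts \<kappa>" "elementary Y H (\<lambda>x. x)"
    "\<And>A. A \<in> Y \<Longrightarrow> elts A \<in> U \<Longrightarrow> \<alpha> \<in> elts A"
proof -
  define Z where "Z \<beta> = hull H \<kappa> ({\<kappa>, w} \<union> insert \<beta> (elts \<beta>))" for \<beta>
  define E where "E \<beta> = {\<alpha> \<in> elts \<kappa>. \<forall>x\<in>Z \<beta>.
    (x \<in> elts \<kappa> \<longrightarrow> x \<in> elts \<alpha>) \<and> (elts x \<in> U \<longrightarrow> \<alpha> \<in> elts x)}" for \<beta>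
  have "E \<beta> \<in> U" if \<beta>: "\<beta> \<in> elts \<kappa>" for \<beta>
  proof -
    have "insert \<kappa> (insert w (insert \<beta> (elts \<beta>))) \<prec> elts \<kappa>"
      by (intro insert_lesspoll_\<kappa> Card_mem_lesspoll[OF Card_\<kappa> \<beta>])
    then have Z: "Z \<beta> \<prec> elts \<kappa>" unfolding Z_def by (intro hull_lesspoll_\<kappa>) (simp add: insert_commute)
    define B where "B x = {\<alpha> \<in> elts \<kappa>. x \<in> elts \<kappa> \<longrightarrow> x \<in> elts \<alpha>} \<inter>
      (if elts x \<in> U then elts x else elts \<kappa>)" for x
    have "B x \<in> U" for x
    proof -
      have "{\<alpha> \<in> elts \<kappa>. x \<in> elts \<kappa> \<longrightarrow> x \<in> elts \<alpha>} \<in> U"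
        using unbounded \<kappa>_in_U by (cases "x \<in> elts \<kappa>") auto
      moreover have "(if elts x \<in> U then elts x else elts \<kappa>) \<in> U" using \<kappa>_in_U by simp
      ultimately show ?thesis unfolding B_def by (rule Int_in_U)
    qed
    then have "{\<alpha> \<in> elts \<kappa>. \<forall>x\<in>Z \<beta>. \<alpha> \<in> B x} \<in> U" by (intro INT_in_U[OF Z])
    also have "{\<alpha> \<in> elts \<kappa>. \<forall>x\<in>Z \<beta>. \<alpha> \<in> B x} = E \<beta>"
      by (auto simp: B_def E_def split: if_splits)
    finally show ?thesis .
  qed
  then have \<Delta>: "{\<alpha> \<in> elts \<kappa>. \<forall>\<beta>\<in>elts \<alpha>. \<alpha> \<in> E \<beta>} \<in> U" by (rule diagonal)
  \<comment> \<open>Any \<open>\<gamma> < \<kappa>\<close> serves to make \<open>\<alpha>\<close> nonzero, so that at least one hull enters the union.\<close>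
  obtain \<gamma> where "\<gamma> \<in> elts \<kappa>" using in_U_nonempty[OF \<kappa>_in_U] by blast
  from in_U_nonempty[OF Int_in_U[OF \<Delta> unbounded[OF this]]] obtain \<alpha>
    where \<alpha>: "\<alpha> \<in> elts \<kappa>" "\<gamma> \<in> elts \<alpha>" "\<And>\<beta>. \<beta> \<in> elts \<alpha> \<Longrightarrow> \<alpha> \<in> E \<beta>" by blast
  have Ord_\<alpha>: "Ord \<alpha>" using Ord_in_Ord[OF Ord_\<kappa> \<alpha>(1)] .
  have below: "elts \<alpha> \<subseteq> elts \<kappa>" using Ord_trans[OF Ord_\<kappa> \<alpha>(1)] by blast
  define Y where "Y = (\<Union>\<beta>\<in>elts \<alpha>. Z \<beta>)"
  have gen: "{\<kappa>, w} \<union> insert \<beta> (elts \<beta>) \<subseteq> Z \<beta>" for \<beta>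
    unfolding Z_def by (rule subset_hull)
  have Z_mono: "Z \<beta> \<subseteq> Z \<beta>'" if "\<beta> \<in> elts \<alpha>" "\<beta>' \<in> elts \<alpha>" "\<beta>' \<notin> elts \<beta>" for \<beta> \<beta>'
  proof -
    have "Ord \<beta>" "Ord \<beta>'" using that Ord_in_Ord[OF Ord_\<alpha>] by auto
    then have "insert \<beta> (elts \<beta>) \<subseteq> insert \<beta>' (elts \<beta>')"
      using that(3) Ord_linear[of \<beta> \<beta>'] Ord_trans[of \<beta>' \<beta>] by blast
    then show ?thesis unfolding Z_def by (intro hull_mono) blast
  qed
  have list: "\<exists>\<beta>\<in>elts \<alpha>. set l \<subseteq> Z \<beta>" if "set l \<subseteq> Y" for l
    using that
  proof (induction l)
    case (Cons x l)
    then obtain \<beta> \<beta>' where b: "\<beta> \<in> elts \<alpha>" "x \<in> Z \<beta>" "\<beta>' \<in> elts \<alpha>" "set l \<subseteq> Z \<beta>'"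
      by (auto simp: Y_def)
    show ?case
    proof (cases "\<beta>' \<in> elts \<beta>")
      case True
      then have "Z \<beta>' \<subseteq> Z \<beta>" using Z_mono b(1,3) mem_asym by blast
      then show ?thesis using b(1,2,4) by auto
    next
      case False
      then have "Z \<beta> \<subseteq> Z \<beta>'" using Z_mono b(1,3) by blast
      then show ?thesis using b(2,3,4) by auto
    qed
  qed (use \<alpha>(2) in auto)
  have ZH: "Z \<beta> \<subseteq> H" if "\<beta> \<in> elts \<alpha>" for \<beta>
  proof -
    have "\<beta> \<in> elts \<kappa>" using that below by blast
    then have "insert \<beta> (elts \<beta>) \<subseteq> elts \<kappa>" using Ord_trans[OF Ord_\<kappa>] by blast
    then show ?thesis unfolding Z_def using assms by (intro hull_subset) auto
  qed
  show thesis
  proof (rule that[of \<alpha> Y])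
    show "\<alpha> \<in> elts \<kappa>" by fact
    show YH: "Y \<subseteq> H" using ZH by (auto simp: Y_def)
    show "\<kappa> \<in> Y" "w \<in> Y" using gen \<alpha>(2) by (auto simp: Y_def)
    show "Y \<inter> elts \<kappa> = elts \<alpha>"
    proof
      show "Y \<inter> elts \<kappa> \<subseteq> elts \<alpha>" using \<alpha>(3) by (auto simp: Y_def E_def)
      show "elts \<alpha> \<subseteq> Y \<inter> elts \<kappa>" using gen below by (auto simp: Y_def)
    qed
    show "\<alpha> \<in> elts A" if "A \<in> Y" "elts A \<in> U" for A
      using \<alpha>(3) that by (auto simp: Y_def E_def)
    have "Y \<subseteq> hull H \<kappa> ({\<kappa>, w} \<union> elts \<alpha>)"
    proof -
      have "Z \<beta> \<subseteq> hull H \<kappa> ({\<kappa>, w} \<union> elts \<alpha>)" if "\<beta> \<in> elts \<alpha>" for \<beta>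
        unfolding Z_def using that Ord_trans[OF Ord_\<alpha> that] by (intro hull_mono) blast
      then show ?thesis by (auto simp: Y_def)
    qed
    moreover have "insert \<kappa> (insert w (elts \<alpha>)) \<prec> elts \<kappa>"
      by (intro insert_lesspoll_\<kappa> Card_mem_lesspoll[OF Card_\<kappa> \<alpha>(1)])
    then have "hull H \<kappa> ({\<kappa>, w} \<union> elts \<alpha>) \<prec> elts \<kappa>" by (intro hull_lesspoll_\<kappa>) (simp add: insert_commute)
    ultimately show "Y \<prec> elts \<kappa>" using lesspoll_trans1 subset_imp_lepoll by blast
    show "elementary Y H (\<lambda>x. x)"
    proof (rule skolem_closed_elementary[OF YH, of \<kappa>])
      fix i p l assume "set l \<subseteq> Y"
      then obtain \<beta> where "\<beta> \<in> elts \<alpha>" "set l \<subseteq> Z \<beta>" using list by blast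
      then have "skolem H \<kappa> i p l \<in> Z \<beta>" unfolding Z_def by (intro hull_closed)
      then show "skolem H \<kappa> i p l \<in> Y" using \<open>\<beta> \<in> elts \<alpha>\<close> unfolding Y_def by blast
    qed
  qed
qed

end

lemma sat_isomorphism:
  assumes "j ` M = Y" "inj_on j M" "\<And>x y. x \<in> M \<Longrightarrow> y \<in> M \<Longrightarrow> j x \<in> elts (j y) \<longleftrightarrow> x \<in> elts y"
    and "range s \<subseteq> M"
  shows "sat M p s \<longleftrightarrow> sat Y p (j \<circ> s)"
  using assms(4)
proof (induction p arbitrary: s)
  case (Mem i k)
  then have "s i \<in> M" "s k \<in> M" by auto
  then show ?case using assms(3) by simp
next
  case (Eq i k)
  then have "s i \<in> M" "s k \<in> M" by auto
  then show ?case using assms(2) by (simp add: inj_on_eq_iff)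
next
  case (Ex i p)
  have "sat M p (s(i := a)) \<longleftrightarrow> sat Y p ((j \<circ> s)(i := j a))" if "a \<in> M" for a
  proof -
    have "range (s(i := a)) \<subseteq> M" using that Ex.prems by auto
    then have "sat M p (s(i := a)) \<longleftrightarrow> sat Y p (j \<circ> (s(i := a)))" by (rule Ex.IH)
    moreover have "j \<circ> (s(i := a)) = (j \<circ> s)(i := j a)" by (rule fun_upd_comp)
    ultimately show ?thesis by metis
  qed
  then show ?case unfolding assms(1)[symmetric] by (simp add: comp_def)
next
  case (Neg p)
  then show ?case by simp
next
  case (Conj p q)
  then show ?case by simp
qed

text \<open>The embedding is the inverse of the transitive collapse \<open>G\<close> of the submodel \<open>Y\<close>. As \<open>Y\<close> meets
  \<open>\<kappa>\<close> in \<open>\<alpha>\<close>, the collapse is the identity below \<open>\<alpha>\<close> and sends \<open>\<kappa>\<close> to \<open>\<alpha>\<close>. The element of \<open>M\<close> that is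
  asked for is the collapse of the measure: for \<open>A \<in> Y\<close>, if \<open>A\<close> is in the measure then \<open>\<alpha> \<in> A\<close> by the
  choice of \<open>Y\<close>, and if not, then the complement of \<open>A\<close> is in the measure and also in \<open>Y\<close> by
  elementarity, so \<open>\<alpha> \<notin> A\<close>.\<close>

lemma (in normal_measure) ex_small_embedding:
  assumes \<theta>: "Card \<theta>" "\<kappa> \<in> elts \<theta>" "{v. elts v \<subseteq> elts \<kappa>} \<prec> elts \<theta>"
  obtains M j D where "small_embedding \<kappa> \<theta> M j" "D \<in> elts M"
    "elts D = {A \<in> elts M. elts A \<subseteq> elts (crit (elts M) j) \<and> crit (elts M) j \<in> elts (j A)}"
proof -
  define H where "H = Hset \<theta>"
  define w where "w = set_of {v. elts v \<in> U}"
  have "{v. elts v \<in> U} \<subseteq> {v. elts v \<subseteq> elts \<kappa>}" using in_U_subset by blast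
  then have w: "elts w = {v. elts v \<in> U}"
    unfolding w_def by (rule elts_set_of[OF small_subset[OF small_powerset]])
  have trP: "Transitive {v. elts v \<subseteq> elts \<kappa>}"
    using Ord_trans[OF Ord_\<kappa>] unfolding Transitive_def by blast
  have wH: "w \<in> H"
    unfolding H_def using w in_U_subset by (intro HsetI[OF _ trP \<theta>(3)]) auto
  have tr\<kappa>: "Transitive (elts \<kappa>)" using Ord_\<kappa> by (simp add: Ord_def)
  have \<kappa>H: "\<kappa> \<in> H"
    unfolding H_def by (rule HsetI[OF subset_refl tr\<kappa> Card_mem_lesspoll[OF \<theta>(1,2)]])
  have trH: "Transitive H" unfolding H_def by (rule Transitive_Hset)
  then have "elts \<kappa> \<subseteq> H" using \<kappa>H by (auto simp: Transitive_def)
  from ex_reflecting_submodel[OF \<kappa>H wH this] obtain \<alpha> Y where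
    \<alpha>: "\<alpha> \<in> elts \<kappa>" and Y: "Y \<subseteq> H" "\<kappa> \<in> Y" "w \<in> Y" "Y \<inter> elts \<kappa> = elts \<alpha>" "Y \<prec> elts \<kappa>"
    and elemY: "elementary Y H (\<lambda>x. x)"
    and in_measure: "\<And>A. A \<in> Y \<Longrightarrow> elts A \<in> U \<Longrightarrow> \<alpha> \<in> elts A" by blast
  have Ord_\<alpha>: "Ord \<alpha>" using Ord_in_Ord[OF Ord_\<kappa> \<alpha>] .

  have extensional: "\<exists>z\<in>Y. \<not> (z \<in> elts x \<longleftrightarrow> z \<in> elts y)" if xy: "x \<in> Y" "y \<in> Y" "x \<noteq> y" for x y
  proof -
    have "\<exists>z. \<not> (z \<in> elts x \<longleftrightarrow> z \<in> elts y)" using xy(3) elts_eqI by blast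
    moreover have "elts x \<subseteq> H" "elts y \<subseteq> H" using xy Y(1) trH by (auto simp: Transitive_def)
    ultimately have "\<exists>z\<in>H. \<not> (z \<in> elts x \<longleftrightarrow> z \<in> elts y)" by blast
    moreover have "sat Y (Ex 4 (Neg (Iff (Mem 4 0) (Mem 4 1)))) (params [x, y]) \<longleftrightarrow>
        sat H (Ex 4 (Neg (Iff (Mem 4 0) (Mem 4 1)))) (params (map (\<lambda>x. x) [x, y]))"
      using xy by (intro elementary_sat[OF elemY]) auto
    ultimately show ?thesis by simp
  qed
  have "small Y" using Y(5) small_lepoll lesspoll_imp_lepoll by blast
  from transitive_collapse[OF this extensional] obtain M :: 'a and G :: "'a \<Rightarrow> 'a" where
    trM: "Transitive (elts M)" and M: "elts M = G ` Y" and inj: "inj_on G Y"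
    and G: "\<And>x. x \<in> Y \<Longrightarrow> elts (G x) = G ` (elts x \<inter> Y)" by blast
  have G_mem: "G x \<in> elts (G y) \<longleftrightarrow> x \<in> elts y" if "x \<in> Y" "y \<in> Y" for x y
    using G[of y] inj that by (auto simp: inj_on_def)

  define j where "j = inv_into Y G"
  have jG: "j (G x) = x" if "x \<in> Y" for x
    unfolding j_def using inj that by (rule inv_into_f_f)
  have j_image: "j ` elts M = Y" using jG unfolding M by (auto simp: image_iff)
  have "inj_on j (elts M)" using jG unfolding M by (auto simp: inj_on_def)
  moreover have "j x \<in> elts (j y) \<longleftrightarrow> x \<in> elts y" if "x \<in> elts M" "y \<in> elts M" for x y
    using that G_mem jG unfolding M by auto
  ultimately have iso: "sat (elts M) p s \<longleftrightarrow> sat Y p (j \<circ> s)" if "range s \<subseteq> elts M" for p s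
    using sat_isomorphism[OF j_image] that by blast
  have elem: "elementary (elts M) H j"
    unfolding elementary_def
  proof (intro conjI allI impI)
    show "j ` elts M \<subseteq> H" using j_image Y(1) by simp
    fix p and s :: "nat \<Rightarrow> 'a" assume s: "range s \<subseteq> elts M"
    then have "range (j \<circ> s) \<subseteq> Y" using j_image by auto
    then have "sat Y p (j \<circ> s) \<longleftrightarrow> sat H p (j \<circ> s)"
      using elemY by (auto simp: elementary_def comp_def)
    then show "sat (elts M) p s \<longleftrightarrow> sat H p (j \<circ> s)" using iso[OF s] by simp
  qed
  interpret full_embedding "elts M" H j
    using Hset_full_embedding elem trM unfolding H_def by blast

  have \<alpha>Y: "elts \<alpha> \<subseteq> Y" using Y(4) by blast
  have G_id: "G \<beta> = \<beta>" if "\<beta> \<in> elts \<alpha>" for \<beta>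
    using foundation that
  proof (induction \<beta> rule: wf_induct_rule)
    case (less \<beta>)
    have sub: "elts \<beta> \<subseteq> elts \<alpha>" using Ord_trans[OF Ord_\<alpha> less.prems] by blast
    have "elts (G \<beta>) = G ` (elts \<beta> \<inter> Y)" using G less.prems \<alpha>Y by blast
    also have "elts \<beta> \<inter> Y = elts \<beta>" using sub \<alpha>Y by blast
    also have "G ` elts \<beta> = elts \<beta>" using less.IH sub by force
    finally show ?case by (rule extensionality)
  qed
  have "G \<kappa> = \<alpha>"
  proof (rule extensionality)
    have "elts (G \<kappa>) = G ` elts \<alpha>" using G[OF Y(2)] Y(4) by (simp add: Int_commute)
    also have "\<dots> = elts \<alpha>" using G_id by force
    finally show "elts (G \<kappa>) = elts \<alpha>" .
  qed
  then have \<alpha>M: "\<alpha> \<in> elts M" and j\<alpha>: "j \<alpha> = \<kappa>" using M jG Y(2) by auto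
  have j_id: "j \<beta> = \<beta>" if "\<beta> \<in> elts \<alpha>" for \<beta>
    using jG[of \<beta>] G_id[OF that] that \<alpha>Y by auto
  have moves: "moves (elts M) j \<alpha>"
    using \<alpha>M Ord_\<alpha> \<alpha> j\<alpha> by (simp add: moves_def)
  have crit: "crit (elts M) j = \<alpha>"
  proof (rule crit_eqI[OF moves])
    fix \<beta> assume \<beta>: "moves (elts M) j \<beta>"
    then have "\<beta> \<notin> elts \<alpha>" using j_id by (auto simp: moves_def)
    then show "elts \<alpha> \<subseteq> elts \<beta>"
      using Ord_not_mem_iff[of \<beta> \<alpha>] Ord_\<alpha> \<beta> by (simp add: moves_def)
  qed
  have "elts M \<lesssim> Y" unfolding M by (rule image_lepoll)
  also have "Y \<prec> elts \<kappa>" by fact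
  also have "elts \<kappa> \<prec> elts \<theta>" using Card_mem_lesspoll[OF \<theta>(1,2)] .
  finally have "M \<in> H" unfolding H_def by (intro HsetI[OF subset_refl trM])
  then have "small_embedding \<kappa> \<theta> M j"
    using Card_\<kappa> \<theta>(1,2) trM elem moves j\<alpha> crit
    unfolding small_embedding_def nontrivial_def H_def by auto
  moreover have "G w \<in> elts M" using M Y(3) by blast
  moreover have "elts (G w) = {A \<in> elts M. elts A \<subseteq> elts (crit (elts M) j) \<and> crit (elts M) j \<in> elts (j A)}"
    unfolding crit
  proof (intro equalityI subsetI)
    fix A assume "A \<in> elts (G w)"
    then obtain v where v: "v \<in> Y" "elts v \<in> U" "A = G v" using G[OF Y(3)] w by auto
    have "elts A = G ` (elts v \<inter> Y)" using v(3) G[OF v(1)] by simp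
    also have "\<dots> \<subseteq> G ` elts \<alpha>" using in_U_subset[OF v(2)] Y(4) by blast
    also have "\<dots> = elts \<alpha>" using G_id by force
    finally have "elts A \<subseteq> elts \<alpha>" .
    moreover have "\<alpha> \<in> elts (j A)" using in_measure[OF v(1,2)] jG[OF v(1)] v(3) by simp
    ultimately show "A \<in> {A \<in> elts M. elts A \<subseteq> elts \<alpha> \<and> \<alpha> \<in> elts (j A)}"
      using M v by simp
  next
    fix A assume "A \<in> {A \<in> elts M. elts A \<subseteq> elts \<alpha> \<and> \<alpha> \<in> elts (j A)}"
    then have A: "A \<in> elts M" "elts A \<subseteq> elts \<alpha>" "\<alpha> \<in> elts (j A)" by auto
    obtain v where v: "v \<in> Y" "A = G v" using A(1) M by auto
    have sub: "elts (j A) \<subseteq> elts \<kappa>" using j_subset[OF A(1) \<alpha>M] A(2) j\<alpha> by simp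
    have "elts (j A) \<in> U"
    proof (rule ccontr)
      assume "elts (j A) \<notin> U"
      then have compl: "elts \<kappa> - elts (j A) \<in> U" using complement_in_U[OF sub] by blast
      obtain d where d: "d \<in> elts M" "elts (j d) = elts (j \<alpha>) - elts (j A)"
        using difference_in_M[OF \<alpha>M A(1)] by blast
      have "j d \<in> Y" using d(1) j_image by blast
      moreover have "elts (j d) \<in> U" using compl d(2) j\<alpha> by simp
      ultimately have "\<alpha> \<in> elts (j d)" by (rule in_measure)
      then show False using d(2) A(3) by simp
    qed
    then have "v \<in> elts w" using w v jG by simp
    then show "A \<in> elts (G w)" using G_mem[OF v(1) Y(3)] v(2) by simp
  qed
  ultimately show thesis by (rule that)
qed

theorem lemma6p1:
  fixes \<kappa> :: "'v::zfc"
  assumes "Card \<kappa>"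
  shows "measurable_card \<kappa> \<longleftrightarrow>
    (\<exists>\<alpha>. Ord \<alpha> \<and> elts \<kappa> \<subseteq> elts \<alpha> \<and>
      (\<forall>\<theta>. Card \<theta> \<and> \<alpha> \<in> elts \<theta> \<longrightarrow>
        (\<exists>M j. small_embedding \<kappa> \<theta> M j \<and>
          (\<exists>D \<in> elts M. elts D =
            {A \<in> elts M. elts A \<subseteq> elts (crit (elts M) j) \<and> crit (elts M) j \<in> elts (j A)}))))"
    (is "_ \<longleftrightarrow> (\<exists>\<alpha>. Ord \<alpha> \<and> elts \<kappa> \<subseteq> elts \<alpha> \<and> (\<forall>\<theta>. Card \<theta> \<and> \<alpha> \<in> elts \<theta> \<longrightarrow> ?Q \<theta>))")
proof
  assume "measurable_card \<kappa>"
  then obtain U where "measure_on \<kappa> U" "nonprincipal_on (elts \<kappa>) U"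
    by (auto simp: measurable_card_def measure_on_def)
  then obtain W where "normal_measure \<kappa> W" by (rule measure_on.ex_normal_measure)
  then interpret normal_measure \<kappa> W .
  obtain \<beta> :: 'v where \<beta>: "Ord \<beta>" "elts \<beta> \<approx> {v. elts v \<subseteq> elts \<kappa>}"
    using ex_Ord_eqpoll[OF small_powerset] .
  \<comment> \<open>Beyond \<open>\<alpha>\<close>, cardinals exceed both \<open>\<kappa>\<close> and the power set of \<open>\<kappa>\<close>, so that the measure is an element
    of \<open>H(\<theta>)\<close>.\<close>
  define \<alpha> where "\<alpha> = set_of (insert \<kappa> (elts \<kappa>) \<union> elts \<beta>)"
  have \<alpha>: "elts \<alpha> = insert \<kappa> (elts \<kappa>) \<union> elts \<beta>"
    unfolding \<alpha>_def by (intro elts_set_of small_Un small_insert small_elts)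
  have "Ord \<alpha>"
    using Ord_\<kappa> \<beta>(1) unfolding Ord_def \<alpha> Transitive_def by blast
  moreover have "?Q \<theta>" if \<theta>: "Card \<theta>" "\<alpha> \<in> elts \<theta>" for \<theta>
  proof -
    have "\<kappa> \<in> elts \<theta>" using Ord_trans[OF Card_Ord[OF \<theta>(1)] \<theta>(2)] \<alpha> by blast
    moreover have "{v. elts v \<subseteq> elts \<kappa>} \<prec> elts \<theta>"
    proof -
      have "{v. elts v \<subseteq> elts \<kappa>} \<lesssim> elts \<beta>" using \<beta>(2) eqpoll_sym eqpoll_imp_lepoll by blast
      also have "elts \<beta> \<lesssim> elts \<alpha>" using \<alpha> by (intro subset_imp_lepoll) blast
      also have "elts \<alpha> \<prec> elts \<theta>" using Card_mem_lesspoll[OF \<theta>] .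
      finally show ?thesis .
    qed
    ultimately obtain M j D where "small_embedding \<kappa> \<theta> M j" "D \<in> elts M"
      "elts D = {A \<in> elts M. elts A \<subseteq> elts (crit (elts M) j) \<and> crit (elts M) j \<in> elts (j A)}"
      by (rule ex_small_embedding[OF \<theta>(1)])
    then show ?thesis by blast
  qed
  ultimately show "\<exists>\<alpha>. Ord \<alpha> \<and> elts \<kappa> \<subseteq> elts \<alpha> \<and> (\<forall>\<theta>. Card \<theta> \<and> \<alpha> \<in> elts \<theta> \<longrightarrow> ?Q \<theta>)"
    using \<alpha> by blast
next
  assume "\<exists>\<alpha>. Ord \<alpha> \<and> elts \<kappa> \<subseteq> elts \<alpha> \<and> (\<forall>\<theta>. Card \<theta> \<and> \<alpha> \<in> elts \<theta> \<longrightarrow> ?Q \<theta>)"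
  then obtain \<alpha> where \<alpha>: "Ord \<alpha>" and Q: "\<And>\<theta>. Card \<theta> \<Longrightarrow> \<alpha> \<in> elts \<theta> \<Longrightarrow> ?Q \<theta>" by blast
  let ?P = "{v. elts v \<subseteq> elts \<kappa>}"
  \<comment> \<open>One sufficiently large cardinal is enough, provided that it also exceeds the power set of \<open>\<kappa>\<close>.\<close>
  have "small (?P \<union> elts \<alpha>)" by (intro small_Un small_powerset small_elts)
  then obtain \<theta> :: 'v where \<theta>: "Card \<theta>" "\<not> elts \<theta> \<lesssim> ?P \<union> elts \<alpha>" by (rule ex_Card_above)
  have "\<not> elts \<theta> \<subseteq> elts \<alpha>" using \<theta>(2) by (meson le_supI2 subset_imp_lepoll)
  then have "\<alpha> \<in> elts \<theta>" using Ord_not_mem_iff[OF \<alpha> Card_Ord[OF \<theta>(1)]] by blast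
  then obtain M j D where "small_embedding \<kappa> \<theta> M j" "D \<in> elts M"
    "elts D = {A \<in> elts M. elts A \<subseteq> elts (crit (elts M) j) \<and> crit (elts M) j \<in> elts (j A)}"
    using Q[OF \<theta>(1)] by blast
  moreover have "?P \<prec> elts \<theta>"
  proof (rule Card_not_lepoll[OF \<theta>(1) small_powerset])
    show "\<not> elts \<theta> \<lesssim> ?P" using \<theta>(2) lepoll_trans subset_imp_lepoll[of ?P "?P \<union> elts \<alpha>"] by blast
  qed
  ultimately show "measurable_card \<kappa>" by (rule measurable_if_small_embedding)
qed

end
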